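(* Let $\Delta$ be a finite set of cardinality $k\geqslant 3$ and let $\ell\geqslant 2$. Let $F$ be a field with $\mathrm{char}(F)=p\geqslant 0$. Then, for the wreath product $S_k\wr S_\ell$ (with $S_k=\mathrm{Sym}(\Delta)$) in its product action on $\Delta^\ell$, $$\mathrm{LinDim}_F(S_k\wr S_\ell,\Delta^\ell)=\begin{cases}(k-2)\ell+1 & \text{if } p\mid k,\\ (k-1)\ell & \text{if } p\nmid k.\end{cases}$$
   Context: A representation over $F$ of an action of a group $G$ on a set $\Omega$ is a pair $(\rho,\varphi)$ where, for some $F$-vector space $V$, $\rho:G\to \mathrm{GL}(V)$ is a homomorphism and $\varphi:\Omega\to V$ is injective with $(\omega^g)\varphi=(\omega\varphi)^{g\rho}$ for all $\omega\in\Omega$, $g\in G$ (maps written on the right). $\mathrm{LinDim}_F(G,\Omega)$ is the minimum of $\dim V$ over all $V$ affording such a representation. For $K\leqslant\mathrm{Sym}(\Delta)$ and $L\leqslant S_\ell$, the wreath product $K\wr L=K^\ell\rtimes L$ acts on $\Delta^\ell$ (product action) by letting $(h_1,\ldots,h_\ell)\in K^\ell$ act coordinatewise, $(\delta_1,\ldots,\delta_\ell)\mapsto(\delta_1^{h_1},\ldots,\delta_\ell^{h_\ell})$, and $\sigma\in L$ permute coordinates, $(\delta_1,\ldots,\delta_\ell)\mapsto(\delta_{1\sigma^{-1}},\ldots,\delta_{\ell\sigma^{-1}})$. When $p=0$, $p\nmid k$. *)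

theory Defs
  imports
    "HOL-Algebra.Algebra"
    "HOL-Algebra.Product_Groups"
    "HOL-Library.Extended_Nat"
    "HOL-Library.Function_Algebras"
begin

section \<open>Linear representations of a group action\<close>

text \<open>
  Maps are written on the left, as in HOL-Algebra: a group \<open>G\<close> acts on \<open>\<Omega>\<close> through
  a homomorphism from \<open>G\<close> to \<^const>\<open>BijGroup\<close> \<open>\<Omega>\<close>, whose product is \<open>g \<circ> f\<close>.
  A vector space is a subspace \<open>V\<close> of an ambient vector space given by its scalar
  multiplication.
\<close>

definition GL_on :: "('f::field \<Rightarrow> 'v::ab_group_add \<Rightarrow> 'v) \<Rightarrow> 'v set \<Rightarrow> ('v \<Rightarrow> 'v) monoid" where
  "GL_on scale V = BijGroup V \<lparr>carrier :=
     {f \<in> Bij V. (\<forall>x\<in>V. \<forall>y\<in>V. f (x + y) = f x + f y) \<and> (\<forall>c. \<forall>x\<in>V. f (scale c x) = scale c (f x))}\<rparr>"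

definition action_representation ::
  "('f::field \<Rightarrow> 'v::ab_group_add \<Rightarrow> 'v) \<Rightarrow> 'v set \<Rightarrow> ('g, 'm) monoid_scheme \<Rightarrow> 'o set \<Rightarrow>
    ('g \<Rightarrow> 'o \<Rightarrow> 'o) \<Rightarrow> ('g \<Rightarrow> 'v \<Rightarrow> 'v) \<Rightarrow> ('o \<Rightarrow> 'v) \<Rightarrow> bool" where
  "action_representation scale V G \<Omega> act \<rho> \<phi> \<longleftrightarrow>
     vector_space scale \<and> module.subspace scale V \<and>
     \<rho> \<in> hom G (GL_on scale V) \<and> \<phi> \<in> \<Omega> \<rightarrow> V \<and> inj_on \<phi> \<Omega> \<and>
     (\<forall>g\<in>carrier G. \<forall>\<omega>\<in>\<Omega>. \<phi> (act g \<omega>) = \<rho> g (\<phi> \<omega>))"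

text \<open>The library's \<open>dim\<close> is \<open>0\<close> on infinite-dimensional spaces; here they get \<open>\<infinity>\<close>.\<close>

definition edim :: "('f::field \<Rightarrow> 'v::ab_group_add \<Rightarrow> 'v) \<Rightarrow> 'v set \<Rightarrow> enat" where
  "edim scale V =
     (if \<exists>B. finite B \<and> V = module.span scale B then enat (vector_space.dim scale V) else \<infinity>)"

definition fun_scale :: "'f::field \<Rightarrow> (nat \<Rightarrow> 'f) \<Rightarrow> (nat \<Rightarrow> 'f)" where
  "fun_scale c v = (\<lambda>i. c * v i)"

text \<open>
  A definition cannot quantify over types, so the spaces \<open>V\<close> below range over the subspaces
  of \<open>F\<^sup>\<nat>\<close>, among which every finite-dimensional space occurs up to isomorphism.
  By \<open>LinDim_le\<close> and \<open>LinDim_attained\<close> below, the result is the minimum over all vector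
  spaces, on any type; it is \<open>\<infinity>\<close> iff there is no finite-dimensional representation.
\<close>

definition LinDim ::
  "'f::field itself \<Rightarrow> ('g, 'm) monoid_scheme \<Rightarrow> 'o set \<Rightarrow> ('g \<Rightarrow> 'o \<Rightarrow> 'o) \<Rightarrow> enat" where
  "LinDim _ G \<Omega> act =
     Inf {edim fun_scale V | (V :: (nat \<Rightarrow> 'f) set) \<rho> \<phi>. action_representation fun_scale V G \<Omega> act \<rho> \<phi>}"

section \<open>Wreath products and their product action\<close>

text \<open>
  \<open>K\<^sup>l \<rtimes> L\<close> for a group \<open>L\<close> of permutations of \<open>{1..l}\<close> (a subgroup of
  \<^const>\<open>sym_group\<close> \<open>l\<close>); the pair \<open>(h, \<sigma>)\<close> stands for the product \<open>h \<sigma>\<close>, and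
  \<open>\<sigma> h \<sigma>\<^sup>-\<^sup>1\<close> has \<open>i\<close>-th coordinate \<open>h (\<sigma>\<^sup>-\<^sup>1 i)\<close>.
\<close>

definition wreath ::
  "nat \<Rightarrow> ('k, 'm) monoid_scheme \<Rightarrow> (nat \<Rightarrow> nat) monoid \<Rightarrow> ((nat \<Rightarrow> 'k) \<times> (nat \<Rightarrow> nat)) monoid" where
  "wreath l K L =
     \<lparr>carrier = carrier (product_group {1..l} (\<lambda>_. K)) \<times> carrier L,
      monoid.mult = (\<lambda>(h, \<sigma>) (h', \<sigma>').
        (h \<otimes>\<^bsub>product_group {1..l} (\<lambda>_. K)\<^esub> (\<lambda>i\<in>{1..l}. h' (inv' \<sigma> i)), \<sigma> \<otimes>\<^bsub>L\<^esub> \<sigma>')),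
      one = (\<one>\<^bsub>product_group {1..l} (\<lambda>_. K)\<^esub>, \<one>\<^bsub>L\<^esub>)\<rparr>"

abbreviation cart_power :: "'a set \<Rightarrow> nat \<Rightarrow> (nat \<Rightarrow> 'a) set" where
  "cart_power \<Delta> l \<equiv> {1..l} \<rightarrow>\<^sub>E \<Delta>"

text \<open>First permute the coordinates by \<open>\<sigma>\<close>, then apply \<open>h\<close> coordinatewise.\<close>

definition product_action ::
  "'a set \<Rightarrow> nat \<Rightarrow> (nat \<Rightarrow> 'a \<Rightarrow> 'a) \<times> (nat \<Rightarrow> nat) \<Rightarrow> (nat \<Rightarrow> 'a) \<Rightarrow> (nat \<Rightarrow> 'a)" where
  "product_action \<Delta> l = (\<lambda>(h, \<sigma>). \<lambda>\<delta>\<in>cart_power \<Delta> l. \<lambda>i\<in>{1..l}. h i (\<delta> (inv' \<sigma> i)))"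

section \<open>Basic properties\<close>

lemma vector_space_fun_scale: "vector_space (fun_scale :: 'f::field \<Rightarrow> _)"
  by unfold_locales (auto simp: fun_scale_def fun_eq_iff algebra_simps)

lemma group_GL_on:
  assumes "vector_space scale" "module.subspace scale V"
  shows "group (GL_on scale V)"
proof -
  interpret vector_space scale by fact
  have add: "x + y \<in> V" and scl: "scale c x \<in> V" if "x \<in> V" "y \<in> V" for x y c
    using assms(2) that by (auto simp: subspace_add subspace_scale)
  interpret B: group "BijGroup V" by (rule group_BijGroup)
  let ?S = "{f \<in> Bij V. (\<forall>x\<in>V. \<forall>y\<in>V. f (x + y) = f x + f y) \<and> (\<forall>c. \<forall>x\<in>V. f (scale c x) = scale c (f x))}"
  have "subgroup ?S (BijGroup V)"
  proof (rule B.subgroupI)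
    show "?S \<subseteq> carrier (BijGroup V)" by (auto simp: BijGroup_def)
    have "(\<lambda>x\<in>V. x) \<in> ?S" using id_Bij[of V] add scl by auto
    then show "?S \<noteq> {}" by blast
  next
    fix f assume f: "f \<in> ?S"
    then have fB: "f \<in> Bij V" by blast
    have "inv_into V f (x + y) = inv_into V f x + inv_into V f y" if "x \<in> V" "y \<in> V" for x y
      by (rule Bij_inv_into_lemma[where g = "(+)"]) (use f fB that add in auto)
    moreover have "inv_into V f (scale c x) = scale c (inv_into V f x)" if "x \<in> V" for x c
      by (rule Bij_inv_into_lemma[where g = "\<lambda>_ z. scale c z" and x = x])
         (use f fB that scl in auto)
    ultimately show "inv\<^bsub>BijGroup V\<^esub> f \<in> ?S"
      using fB add scl by (auto simp: inv_BijGroup restrict_inv_into_Bij)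
  next
    fix f g assume "f \<in> ?S" "g \<in> ?S"
    moreover have "g x \<in> V" if "x \<in> V" "g \<in> Bij V" for g x
      using that Bij_imp_funcset by blast
    ultimately show "f \<otimes>\<^bsub>BijGroup V\<^esub> g \<in> ?S"
      using add scl compose_Bij[of f V g] by (auto simp: BijGroup_def compose_def)
  qed
  then show ?thesis
    unfolding GL_on_def by (rule B.subgroup_imp_group)
qed

lemma LinDim_attained:
  assumes "LinDim TYPE('f::field) G \<Omega> act = enat n"
  obtains V :: "(nat \<Rightarrow> 'f::field) set" and \<rho> \<phi>
  where "action_representation fun_scale V G \<Omega> act \<rho> \<phi>" "edim fun_scale V = enat n"
proof -
  let ?A = "{edim fun_scale V | (V :: (nat \<Rightarrow> 'f) set) \<rho> \<phi>. action_representation fun_scale V G \<Omega> act \<rho> \<phi>}"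
  have "?A \<noteq> {}"
    using assms unfolding LinDim_def Inf_enat_def by (metis enat.distinct(1))
  then have "Inf ?A \<in> ?A"
    unfolding Inf_enat_def by (metis (mono_tags, lifting) LeastI_ex ex_in_conv)
  then show thesis
    using assms that unfolding LinDim_def by auto
qed

lemma LinDim_le:
  fixes scale :: "'f::field \<Rightarrow> 'v::ab_group_add \<Rightarrow> 'v"
  assumes rep: "action_representation scale V G \<Omega> act \<rho> \<phi>"
  shows "LinDim TYPE('f) G \<Omega> act \<le> edim scale V"
proof (cases "\<exists>B. finite B \<and> V = module.span scale B")
  case False
  then show ?thesis unfolding edim_def if_not_P[OF False] by simp
next
  case True
  have vs: "vector_space scale" and sV: "module.subspace scale V"
    and rho: "\<rho> \<in> hom G (GL_on scale V)" and phi: "\<phi> \<in> \<Omega> \<rightarrow> V" "inj_on \<phi> \<Omega>"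
    and eqv: "\<And>g \<omega>. g \<in> carrier G \<Longrightarrow> \<omega> \<in> \<Omega> \<Longrightarrow> \<phi> (act g \<omega>) = \<rho> g (\<phi> \<omega>)"
    using rep unfolding action_representation_def by auto
  interpret v: vector_space scale by fact
  interpret f: vector_space "fun_scale :: 'f \<Rightarrow> _" by (rule vector_space_fun_scale)
  interpret p: vector_space_pair scale "fun_scale :: 'f \<Rightarrow> _" by unfold_locales
  obtain B0 where B0: "finite B0" "V = v.span B0" using True by blast
  obtain B where B: "B \<subseteq> V" "v.independent B" "V \<subseteq> v.span B" "card B = v.dim V"
    by (rule v.basis_exists)
  have finB: "finite B"
    using v.independent_span_bound[OF B0(1) B(2)] B(1) B0(2) by blast
  have VB: "V = v.span B"
    using B sV v.span_minimal by blast
  obtain e :: "'v \<Rightarrow> nat" where e: "inj_on e B"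
    using finB finite_imp_inj_to_nat_seg by metis
  define u where "u b = (\<lambda>i. if i = e b then 1 else (0::'f))" for b
  have inju: "inj_on u B"
  proof (rule inj_onI)
    fix x y assume "x \<in> B" "y \<in> B" "u x = u y"
    then have "u y (e x) = 1" by (metis u_def)
    then have "e x = e y" by (simp add: u_def split: if_splits)
    then show "x = y" using e \<open>x \<in> B\<close> \<open>y \<in> B\<close> by (auto dest: inj_onD)
  qed
  have indu: "f.independent (u ` B)"
  proof (rule f.independent_if_scalars_zero)
    show "finite (u ` B)" using finB by blast
    fix c x assume s: "(\<Sum>x\<in>u ` B. fun_scale (c x) x) = 0" and "x \<in> u ` B"
    then obtain b where b: "b \<in> B" "x = u b" by blast
    have app: "(\<Sum>a\<in>A. h a) i = (\<Sum>a\<in>A. h a i)" for A :: "'v set" and h :: "'v \<Rightarrow> nat \<Rightarrow> 'f" and i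
      by (induction A rule: infinite_finite_induct) auto
    have "0 = (\<Sum>a\<in>B. fun_scale (c (u a)) (u a)) (e b)"
      using s inju by (simp add: sum.reindex)
    also have "\<dots> = (\<Sum>a\<in>B. if a = b then c (u a) else 0)"
      unfolding app
      by (rule sum.cong) (use e b in \<open>auto simp: fun_scale_def u_def dest: inj_onD\<close>)
    also have "\<dots> = c x" using b finB by simp
    finally show "c x = 0" by simp
  qed
  obtain T where T: "Vector_Spaces.linear scale fun_scale T" "\<forall>x\<in>B. T x = u x"
    using p.linear_independent_extend[OF B(2)] by blast
  interpret T: Vector_Spaces.linear scale fun_scale T by fact
  have TB: "T ` B = u ` B" using T(2) by auto
  have injT: "inj_on T V"
    unfolding VB
    by (rule p.linear_inj_on_span_independent_image[OF T(1)])
       (use TB indu inju T(2) in \<open>simp_all add: inj_on_def\<close>)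
  define W where "W = T ` V"
  have sW: "f.subspace W"
    unfolding W_def by (rule T.subspace_image[OF sV])
  have W_span: "W = f.span (T ` B)"
    unfolding W_def VB by (simp add: T.span_image)
  have dimW: "f.dim W = v.dim V"
    unfolding W_span B(4)[symmetric]
    using f.dim_span_eq_card_independent[of "T ` B"] indu TB card_image[OF inju] by simp
  have edimW: "edim fun_scale W = edim scale V"
  proof -
    have "\<exists>C. finite C \<and> W = f.span C" using W_span finB by blast
    then show ?thesis using True dimW by (simp add: edim_def)
  qed
  define S where "S = inv_into V T"
  have ST: "S (T x) = x" if "x \<in> V" for x
    unfolding S_def using injT that by (rule inv_into_f_f)
  define \<rho>' where "\<rho>' g = (\<lambda>w\<in>W. T (\<rho> g (S w)))" for g
  have rB: "\<rho> g \<in> Bij V" and radd: "\<And>x y. x \<in> V \<Longrightarrow> y \<in> V \<Longrightarrow> \<rho> g (x + y) = \<rho> g x + \<rho> g y"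
    and rscl: "\<And>c x. x \<in> V \<Longrightarrow> \<rho> g (scale c x) = scale c (\<rho> g x)" if "g \<in> carrier G" for g
    using hom_carrier[OF rho] that by (auto simp: GL_on_def)
  have rV: "\<rho> g x \<in> V" if "g \<in> carrier G" "x \<in> V" for g x
    using Bij_imp_funcset[OF rB[OF that(1)]] that(2) by blast
  have r'T: "\<rho>' g (T x) = T (\<rho> g x)" if "x \<in> V" for g x
    using that by (simp add: \<rho>'_def W_def ST)
  have r'Bij: "\<rho>' g \<in> Bij W" if g: "g \<in> carrier G" for g
  proof -
    have "bij_betw (\<rho> g) V V" using rB[OF g] by (simp add: Bij_def)
    moreover have "bij_betw T V W" using injT by (simp add: W_def bij_betw_def)
    moreover have "bij_betw S W V"
      unfolding S_def using \<open>bij_betw T V W\<close> by (rule bij_betw_inv_into)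
    ultimately have "bij_betw (T \<circ> (\<rho> g \<circ> S)) W W"
      by (meson bij_betw_trans)
    then have "bij_betw (\<rho>' g) W W"
      by (rule bij_betw_cong[THEN iffD1, rotated]) (simp add: \<rho>'_def)
    then show ?thesis by (simp add: Bij_def \<rho>'_def)
  qed
  have r'GL: "\<rho>' g \<in> carrier (GL_on fun_scale W)" if g: "g \<in> carrier G" for g
  proof -
    have "\<rho>' g (x + y) = \<rho>' g x + \<rho>' g y" if "x \<in> W" "y \<in> W" for x y
    proof -
      obtain a b where ab: "a \<in> V" "b \<in> V" "x = T a" "y = T b" using \<open>x \<in> W\<close> \<open>y \<in> W\<close> W_def by blast
      have "a + b \<in> V" using ab sV by (simp add: v.subspace_add)
      then show ?thesis using ab radd[OF g] r'T by (simp flip: T.add)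
    qed
    moreover have "\<rho>' g (fun_scale c x) = fun_scale c (\<rho>' g x)" if "x \<in> W" for c x
    proof -
      obtain a where a: "a \<in> V" "x = T a" using \<open>x \<in> W\<close> W_def by blast
      have "scale c a \<in> V" using a sV by (simp add: v.subspace_scale)
      then show ?thesis using a rscl[OF g] r'T by (simp flip: T.scale)
    qed
    ultimately show ?thesis using r'Bij[OF g] by (simp add: GL_on_def)
  qed
  have r'hom: "\<rho>' \<in> hom G (GL_on fun_scale W)"
  proof (rule homI)
    show "\<rho>' g \<in> carrier (GL_on fun_scale W)" if "g \<in> carrier G" for g
      using r'GL[OF that] .
    fix g h assume gh: "g \<in> carrier G" "h \<in> carrier G"
    have m: "\<rho> (g \<otimes>\<^bsub>G\<^esub> h) = compose V (\<rho> g) (\<rho> h)"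
      using hom_mult[OF rho gh] rB gh by (simp add: GL_on_def BijGroup_def)
    have "\<rho>' (g \<otimes>\<^bsub>G\<^esub> h) = compose W (\<rho>' g) (\<rho>' h)"
    proof
      fix w
      show "\<rho>' (g \<otimes>\<^bsub>G\<^esub> h) w = compose W (\<rho>' g) (\<rho>' h) w"
      proof (cases "w \<in> W")
        case True
        then obtain a where "a \<in> V" "w = T a" using W_def by blast
        then show ?thesis using True rV gh by (simp add: compose_def r'T m)
      qed (simp add: \<rho>'_def compose_def)
    qed
    then show "\<rho>' (g \<otimes>\<^bsub>G\<^esub> h) = \<rho>' g \<otimes>\<^bsub>GL_on fun_scale W\<^esub> \<rho>' h"
      using r'Bij gh by (simp add: GL_on_def BijGroup_def)
  qed
  have "action_representation fun_scale W G \<Omega> act \<rho>' (T \<circ> \<phi>)"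
    unfolding action_representation_def
  proof (intro conjI ballI)
    show "inj_on (T \<circ> \<phi>) \<Omega>"
      using phi injT by (intro comp_inj_on) (auto intro: inj_on_subset)
  qed (use vector_space_fun_scale sW r'hom phi W_def eqv r'T in \<open>auto simp: Pi_iff\<close>)
  then show ?thesis
    unfolding LinDim_def edimW[symmetric] by (intro Inf_lower) blast
qed

lemma perm_carrier_inv:
  assumes "subgroup H (sym_group l)" "\<sigma> \<in> H"
  shows "\<sigma> permutes {1..l}" "inv' \<sigma> \<in> H" "i \<in> {1..l} \<Longrightarrow> inv' \<sigma> i \<in> {1..l}"
proof -
  show *: "\<sigma> permutes {1..l}"
    using subgroup.mem_carrier[OF assms] by (simp add: sym_group_carrier)
  show "inv' \<sigma> \<in> H"
    using subgroup.m_inv_closed[OF assms] sym_group_inv_equality[of \<sigma> l] *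
    by (simp add: sym_group_carrier)
  show "inv' \<sigma> i \<in> {1..l}" if "i \<in> {1..l}"
    using permutes_in_image[OF permutes_inv[OF *]] that by blast
qed

lemma group_wreath:
  assumes "group K" and H: "subgroup H (sym_group l)"
  shows "group (wreath l K (sym_group l\<lparr>carrier := H\<rparr>))"
proof -
  interpret K: group K by fact
  note [simp] = wreath_def sym_group_mult sym_group_one
  note c = subgroup.m_closed[OF H, unfolded sym_group_mult] subgroup.one_closed[OF H, unfolded sym_group_one]
  have inv_comp: "inv' (\<sigma> \<circ> \<tau>) = inv' \<tau> \<circ> inv' \<sigma>" if "\<sigma> \<in> H" "\<tau> \<in> H" for \<sigma> \<tau>
    using permutes_bij[OF perm_carrier_inv(1)[OF H]] that by (intro o_inv_distrib)
  show ?thesis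
  proof (rule groupI, goal_cases)
    case (1 x y)
    then show ?case using perm_carrier_inv[OF H] c by (auto simp: PiE_iff)
  next
    case 2
    then show ?case using c by auto
  next
    case (3 x y z)
    then show ?case
      using perm_carrier_inv(3)[OF H]
      by (auto simp: PiE_iff K.m_assoc inv_comp comp_assoc intro!: restrict_ext)
  next
    case (4 x)
    then show ?case by (auto simp: PiE_iff extensional_def fun_eq_iff)
  next
    case (5 x)
    obtain h \<sigma> where x: "x = (h, \<sigma>)" by (cases x)
    with 5 have h: "h \<in> {1..l} \<rightarrow>\<^sub>E carrier K" and s: "\<sigma> \<in> H" by auto
    have p: "\<sigma> permutes {1..l}" using perm_carrier_inv(1)[OF H s] .
    have si: "\<sigma> i \<in> {1..l}" if "i \<in> {1..l}" for i using permutes_in_image[OF p] that by blast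
    show ?case
    proof (rule bexI)
      let ?y = "(\<lambda>i\<in>{1..l}. inv\<^bsub>K\<^esub> h (\<sigma> i), inv' \<sigma>)"
      show "?y \<otimes>\<^bsub>wreath l K (sym_group l\<lparr>carrier := H\<rparr>)\<^esub> x =
          \<one>\<^bsub>wreath l K (sym_group l\<lparr>carrier := H\<rparr>)\<^esub>"
        using h si p x by (auto simp: inv_inv_eq permutes_bij permutes_inv_o PiE_iff intro!: restrict_ext)
      show "?y \<in> carrier (wreath l K (sym_group l\<lparr>carrier := H\<rparr>))"
        using h si perm_carrier_inv(2)[OF H s] by (auto simp: PiE_iff)
    qed
  qed
qed

lemma product_action_Bij:
  assumes h: "\<And>i. i \<in> {1..l} \<Longrightarrow> h i \<in> Bij \<Delta>" and p: "\<sigma> permutes {1..l}"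
  shows "product_action \<Delta> l (h, \<sigma>) \<in> Bij (cart_power \<Delta> l)"
proof -
  have bb: "bij_betw (h i) \<Delta> \<Delta>" if "i \<in> {1..l}" for i using h[OF that] by (simp add: Bij_def)
  have si: "\<sigma> i \<in> {1..l} \<longleftrightarrow> i \<in> {1..l}" "inv' \<sigma> i \<in> {1..l} \<longleftrightarrow> i \<in> {1..l}" for i
    using permutes_in_image[OF p] permutes_in_image[OF permutes_inv[OF p]] by auto
  have "bij_betw (product_action \<Delta> l (h, \<sigma>)) (cart_power \<Delta> l) (cart_power \<Delta> l)"
  proof (rule bij_betw_byWitness[where f' = "\<lambda>\<delta>. \<lambda>i\<in>{1..l}. inv_into \<Delta> (h (\<sigma> i)) (\<delta> (\<sigma> i))"])
    show "\<forall>\<delta>\<in>cart_power \<Delta> l. (\<lambda>i\<in>{1..l}. inv_into \<Delta> (h (\<sigma> i)) (product_action \<Delta> l (h, \<sigma>) \<delta> (\<sigma> i))) = \<delta>"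
    proof
      fix \<delta> assume d: "\<delta> \<in> cart_power \<Delta> l"
      show "(\<lambda>i\<in>{1..l}. inv_into \<Delta> (h (\<sigma> i)) (product_action \<Delta> l (h, \<sigma>) \<delta> (\<sigma> i))) = \<delta>"
      proof (rule PiE_ext[OF _ d])
        fix i assume i: "i \<in> {1..l}"
        have "inv_into \<Delta> (h (\<sigma> i)) (h (\<sigma> i) (\<delta> i)) = \<delta> i"
          using bb[of "\<sigma> i"] i d si by (intro inv_into_f_f) (auto simp: bij_betw_def)
        then show "(\<lambda>i\<in>{1..l}. inv_into \<Delta> (h (\<sigma> i)) (product_action \<Delta> l (h, \<sigma>) \<delta> (\<sigma> i))) i = \<delta> i"
          using i d si permutes_inverses(2)[OF p] by (simp add: product_action_def)
      next
        show "(\<lambda>i\<in>{1..l}. inv_into \<Delta> (h (\<sigma> i)) (product_action \<Delta> l (h, \<sigma>) \<delta> (\<sigma> i))) \<in> cart_power \<Delta> l"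
          using d si bb permutes_inverses(2)[OF p]
          by (auto simp: product_action_def PiE_iff bij_betw_def simp del: atLeastAtMost_iff)
      qed
    qed
    show "\<forall>\<delta>\<in>cart_power \<Delta> l. product_action \<Delta> l (h, \<sigma>) (\<lambda>i\<in>{1..l}. inv_into \<Delta> (h (\<sigma> i)) (\<delta> (\<sigma> i))) = \<delta>"
    proof
      fix \<delta> assume d: "\<delta> \<in> cart_power \<Delta> l"
      have iv: "inv_into \<Delta> (h j) (\<delta> j) \<in> \<Delta>" "h j (inv_into \<Delta> (h j) (\<delta> j)) = \<delta> j" if "j \<in> {1..l}" for j
      proof -
        have "\<delta> j \<in> h j ` \<Delta>" using d that bb[OF that] by (auto simp: bij_betw_def)
        then show "inv_into \<Delta> (h j) (\<delta> j) \<in> \<Delta>" "h j (inv_into \<Delta> (h j) (\<delta> j)) = \<delta> j"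
          by (auto intro: inv_into_into f_inv_into_f)
      qed
      then have mem: "(\<lambda>i\<in>{1..l}. inv_into \<Delta> (h (\<sigma> i)) (\<delta> (\<sigma> i))) \<in> cart_power \<Delta> l"
        using si by (auto simp del: atLeastAtMost_iff)
      show "product_action \<Delta> l (h, \<sigma>) (\<lambda>i\<in>{1..l}. inv_into \<Delta> (h (\<sigma> i)) (\<delta> (\<sigma> i))) = \<delta>"
        using mem d iv si permutes_inverses(1)[OF p]
        by (auto simp: product_action_def PiE_iff extensional_def fun_eq_iff simp del: atLeastAtMost_iff)
    qed
    show "product_action \<Delta> l (h, \<sigma>) ` cart_power \<Delta> l \<subseteq> cart_power \<Delta> l"
      using si bij_betwE[OF bb] by (auto simp: product_action_def PiE_iff simp del: atLeastAtMost_iff One_nat_def)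
    show "(\<lambda>\<delta>. \<lambda>i\<in>{1..l}. inv_into \<Delta> (h (\<sigma> i)) (\<delta> (\<sigma> i))) ` cart_power \<Delta> l \<subseteq> cart_power \<Delta> l"
      using si bb by (auto simp: bij_betw_def PiE_iff simp del: atLeastAtMost_iff intro!: inv_into_into)
  qed
  then show ?thesis by (simp add: Bij_def product_action_def)
qed

lemma group_action_product_action:
  assumes "subgroup K (BijGroup \<Delta>)" and H: "subgroup H (sym_group l)"
  shows "group_action (wreath l (BijGroup \<Delta>\<lparr>carrier := K\<rparr>) (sym_group l\<lparr>carrier := H\<rparr>))
           (cart_power \<Delta> l) (product_action \<Delta> l)"
proof -
  let ?G = "wreath l (BijGroup \<Delta>\<lparr>carrier := K\<rparr>) (sym_group l\<lparr>carrier := H\<rparr>)"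
  have K: "K \<subseteq> Bij \<Delta>" using subgroup.subset[OF assms(1)] by (simp add: BijGroup_def)
  have grp: "group ?G"
    by (rule group_wreath[OF group.subgroup_imp_group[OF group_BijGroup assms(1)] H])
  have bij: "product_action \<Delta> l x \<in> Bij (cart_power \<Delta> l)" if "x \<in> carrier ?G" for x
    using that K perm_carrier_inv(1)[OF H]
    by (auto simp: wreath_def PiE_iff simp del: atLeastAtMost_iff One_nat_def intro!: product_action_Bij)
  have "product_action \<Delta> l \<in> hom ?G (BijGroup (cart_power \<Delta> l))"
  proof (rule homI)
    show "product_action \<Delta> l x \<in> carrier (BijGroup (cart_power \<Delta> l))" if "x \<in> carrier ?G" for x
      using bij[OF that] by (simp add: BijGroup_def)
    fix x y assume xy: "x \<in> carrier ?G" "y \<in> carrier ?G"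
    obtain h \<sigma> h' \<sigma>' where e: "x = (h, \<sigma>)" "y = (h', \<sigma>')" by (cases x, cases y)
    have hh: "h i \<in> Bij \<Delta>" "h' i \<in> Bij \<Delta>" if "i \<in> {1..l}" for i
      using xy K that unfolding e by (auto simp: wreath_def)
    have s: "\<sigma> \<in> H" "\<sigma>' \<in> H" using xy unfolding e by (auto simp: wreath_def)
    have inv_comp: "inv' (\<sigma> \<circ> \<sigma>') = inv' \<sigma>' \<circ> inv' \<sigma>"
      using permutes_bij[OF perm_carrier_inv(1)[OF H]] s by (intro o_inv_distrib)
    have "product_action \<Delta> l (x \<otimes>\<^bsub>?G\<^esub> y) \<delta> = compose (cart_power \<Delta> l) (product_action \<Delta> l x) (product_action \<Delta> l y) \<delta>" for \<delta>
    proof (cases "\<delta> \<in> cart_power \<Delta> l")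
      case True
      have "product_action \<Delta> l y \<delta> \<in> cart_power \<Delta> l"
        using Bij_imp_funcset[OF bij[OF xy(2)]] True by blast
      moreover have "\<delta> i \<in> \<Delta>" if "i \<in> {1..l}" for i using True that by blast
      ultimately show ?thesis
        using True hh perm_carrier_inv(3)[OF H] s
        by (auto simp: e product_action_def wreath_def BijGroup_def compose_def sym_group_mult inv_comp
            simp del: atLeastAtMost_iff intro!: restrict_ext)
    qed (simp add: compose_def product_action_def e wreath_def)
    then show "product_action \<Delta> l (x \<otimes>\<^bsub>?G\<^esub> y) =
        product_action \<Delta> l x \<otimes>\<^bsub>BijGroup (cart_power \<Delta> l)\<^esub> product_action \<Delta> l y"
      using bij[OF xy(1)] bij[OF xy(2)] by (auto simp: BijGroup_def)
  qed
  then show ?thesis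
    using grp group_BijGroup[of "cart_power \<Delta> l"]
    by (simp add: group_action_def group_hom_def group_hom_axioms_def)
qed

end

theory Submission
  imports Defs
begin

text \<open>
  The lower bound is proved on the dual side. For a representation \<open>(\<rho>, \<phi>)\<close> on \<open>V\<close>, the functions
  \<open>L \<circ> \<phi>\<close> with \<open>L\<close> a linear functional on \<open>V\<close> form a space \<open>S\<close> of functions on \<open>\<Delta>\<^sup>l\<close>
  that is invariant under the wreath product, has dimension at most \<open>dim V\<close>, and contains a
  nonconstant function, because functionals separate the vectors \<open>\<phi> \<delta>\<close>. So it suffices to bound the
  dimension of an invariant space \<open>S\<close> with a nonconstant member.

  Write \<open>e\<^sub>a\<close> for the indicator function of \<open>a\<close> on \<open>\<Delta>\<close>. Subtracting from a function its
  translate under the transposition of \<open>a\<close> and \<open>b\<close> in the \<open>j\<close>-th coordinate splits off a factor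
  \<open>e\<^sub>a - e\<^sub>b\<close> in that coordinate and leaves a function of the other coordinates. Starting
  from a nonconstant member and repeating this as long as the remaining function is not constant, one
  arrives at a pure product of factors \<open>e\<^sub>a - e\<^sub>b\<close>, one for each coordinate in a nonempty
  set \<open>I\<close> (lemma \<open>exists_diff_prod_mem\<close>). Since \<open>Sym \<Delta>\<close> is 2-transitive and \<open>S\<^sub>l\<close> moves
  \<open>I\<close> to every set of the same size \<open>m\<close>, all such products over all sets of size \<open>m\<close> lie in
  \<open>S\<close> (\<open>contains_some_degree\<close>).

  If \<open>k\<close> is nonzero in the field, then \<open>1\<close> and the \<open>e\<^sub>a - e\<^sub>b\<close> for a fixed \<open>b\<close> form a
  basis of the functions on \<open>\<Delta>\<close>, so the products of degree \<open>m\<close> contribute \<open>(l choose m) (k - 1)\<^sup>m\<close>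
  elements of the tensor product basis, and this number is least for \<open>m = 1\<close>.
  If \<open>k = 0\<close> in the field, then the sum of \<open>e\<^sub>a - e\<^sub>b\<close> over all \<open>a\<close> is the constant
  \<open>1\<close>. Summing over one coordinate therefore lowers the degree (\<open>contains_lower_degree\<close>), so \<open>S\<close>
  contains the constants and all products of degree 1, which span a space of dimension \<open>(k - 2) l + 1\<close>.

  For the upper bound, let \<open>W\<close> be the quotient of \<open>F\<^sup>\<Delta>\<close> by the constants; a point of \<open>\<Delta>\<^sup>l\<close> is
  sent to the tuple of the classes of the \<open>e\<^sub>x\<close>, \<open>x\<close> running over its coordinates, in \<open>W\<^sup>l\<close>. As
  \<open>k \<ge> 3\<close>, no difference of two indicator functions is constant, so this is injective. The span of
  the image has the required dimension: when \<open>k = 0\<close> in \<open>F\<close>, the differences of the classes of the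
  \<open>e\<^sub>x\<close> span only a hyperplane of \<open>W\<close>, and the span is a translation vector together with \<open>l\<close> copies
  of that hyperplane.
\<close>

section \<open>Bounding the dimension by functionals\<close>

definition functional_on :: "('f::field \<Rightarrow> 'v::ab_group_add \<Rightarrow> 'v) \<Rightarrow> 'v set \<Rightarrow> ('v \<Rightarrow> 'f) \<Rightarrow> bool" where
  "functional_on scale V L \<longleftrightarrow>
     (\<forall>x\<in>V. \<forall>y\<in>V. L (x + y) = L x + L y) \<and> (\<forall>c. \<forall>x\<in>V. L (scale c x) = c * L x)"

definition pulled_back_functionals ::
  "('f::field \<Rightarrow> 'v::ab_group_add \<Rightarrow> 'v) \<Rightarrow> 'v set \<Rightarrow> 'o set \<Rightarrow> ('o \<Rightarrow> 'v) \<Rightarrow> ('o \<Rightarrow> 'f) set" where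
  "pulled_back_functionals scale V \<Omega> \<phi> =
     {f. \<exists>L. functional_on scale V L \<and> (\<forall>\<omega>\<in>\<Omega>. f \<omega> = L (\<phi> \<omega>))}"

lemma functional_on_sum:
  assumes "vector_space scale" "module.subspace scale V" and L: "functional_on scale V L"
    and "\<And>a. a \<in> A \<Longrightarrow> f a \<in> V"
  shows "L (\<Sum>a\<in>A. scale (c a) (f a)) = (\<Sum>a\<in>A. c a * L (f a))"
proof -
  interpret vector_space scale by fact
  have 0: "L 0 = 0"
    using L subspace_0[OF assms(2)] unfolding functional_on_def
    by (metis mult_zero_left scale_zero_left)
  show ?thesis
    using assms(4)
  proof (induction A rule: infinite_finite_induct)
    case (insert x A)
    have "scale (c x) (f x) \<in> V" "(\<Sum>a\<in>A. scale (c a) (f a)) \<in> V"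
      using insert.prems assms(2) by (auto intro!: subspace_scale subspace_sum)
    then show ?case
      using insert L by (simp add: functional_on_def)
  qed (use 0 in simp_all)
qed

text \<open>
  A family in the space of pulled back functions together with a dual family of weights (so that the
  pairings form an identity matrix) has at most \<open>dim V\<close> members: the weights turn into vectors of
  \<open>V\<close> on which the corresponding functionals take the values of an identity matrix, which makes these
  vectors linearly independent.
\<close>

lemma biorthogonal_card_le_edim:
  fixes scale :: "'f::field \<Rightarrow> 'v::ab_group_add \<Rightarrow> 'v"
  assumes vs: "vector_space scale" and sub: "module.subspace scale V"
    and phi: "\<phi> \<in> \<Omega> \<rightarrow> V" and J: "finite J"
    and g: "\<And>j. j \<in> J \<Longrightarrow> g j \<in> pulled_back_functionals scale V \<Omega> \<phi>"
    and K: "\<And>i j. i \<in> J \<Longrightarrow> j \<in> J \<Longrightarrow> (\<Sum>\<omega>\<in>\<Omega>. K i \<omega> * g j \<omega>) = of_bool (i = j)"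
  shows "enat (card J) \<le> edim scale V"
proof (cases "\<exists>B. finite B \<and> V = module.span scale B")
  case False
  then show ?thesis unfolding edim_def if_not_P[OF False] by simp
next
  case True
  interpret vector_space scale by fact
  obtain B0 where B0: "finite B0" "V = span B0" using True by blast
  obtain B where B: "B \<subseteq> V" "independent B" "V \<subseteq> span B" "card B = dim V"
    by (rule basis_exists)
  have finB: "finite B"
    using independent_span_bound[OF B0(1) B(2)] B(1) B0(2) by blast
  have "\<forall>j\<in>J. \<exists>L. functional_on scale V L \<and> (\<forall>\<omega>\<in>\<Omega>. g j \<omega> = L (\<phi> \<omega>))"
    using g unfolding pulled_back_functionals_def by blast
  then obtain L where L: "\<And>j. j \<in> J \<Longrightarrow> functional_on scale V (L j)"
    "\<And>j \<omega>. j \<in> J \<Longrightarrow> \<omega> \<in> \<Omega> \<Longrightarrow> g j \<omega> = L j (\<phi> \<omega>)"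
    by metis
  define x where "x i = (\<Sum>\<omega>\<in>\<Omega>. scale (K i \<omega>) (\<phi> \<omega>))" for i
  have xV: "x i \<in> V" for i
    unfolding x_def using phi sub by (intro subspace_sum subspace_scale) auto
  have Lx: "L j (x i) = of_bool (i = j)" if "i \<in> J" "j \<in> J" for i j
  proof -
    have "L j (x i) = (\<Sum>\<omega>\<in>\<Omega>. K i \<omega> * L j (\<phi> \<omega>))"
      unfolding x_def using phi by (intro functional_on_sum[OF vs sub L(1)[OF that(2)]]) auto
    also have "\<dots> = of_bool (i = j)"
      using L(2)[OF that(2)] K[OF that] by simp
    finally show ?thesis .
  qed
  have inj: "inj_on x J"
    by (rule inj_onI) (metis Lx of_bool_eq_iff)
  have "independent (x ` J)"
  proof (rule independent_if_scalars_zero)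
    fix c y assume s: "(\<Sum>y\<in>x ` J. scale (c y) y) = 0" and "y \<in> x ` J"
    then obtain i where i: "i \<in> J" "y = x i" by blast
    have "(\<Sum>j\<in>J. scale (c (x j)) (x j)) = 0"
      using s inj by (simp add: sum.reindex)
    then have "0 = L i (\<Sum>j\<in>J. scale (c (x j)) (x j))"
      using functional_on_sum[OF vs sub L(1)[OF i(1)], of "{}" "\<lambda>_. 0"] by simp
    also have "\<dots> = (\<Sum>j\<in>J. c (x j) * L i (x j))"
      by (rule functional_on_sum[OF vs sub L(1)[OF i(1)]]) (rule xV)
    also have "\<dots> = (\<Sum>j\<in>J. if j = i then c (x j) else 0)"
      by (rule sum.cong) (use Lx i in auto)
    also have "\<dots> = c y" using i J by simp
    finally show "c y = 0" by simp
  qed (use J in simp)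
  then have "card (x ` J) \<le> card B"
    using independent_span_bound[OF finB] xV B(3) by blast
  then show ?thesis
    using True B(4) card_image[OF inj] by (simp add: edim_def)
qed

section \<open>Invariant spaces of functions on the product\<close>

text \<open>
  The members of \<open>S\<close> are total functions, but only their restrictions to \<open>\<Delta>\<^sup>l\<close> matter; closure
  under \<open>cong\<close> makes \<open>S\<close> the full preimage of a space of functions on \<open>\<Delta>\<^sup>l\<close>.
\<close>

locale invariant_functions =
  fixes \<Delta> :: "'a set" and l :: nat and S :: "((nat \<Rightarrow> 'a) \<Rightarrow> 'f::field) set"
  assumes finite_\<Delta>: "finite \<Delta>"
    and cong: "f \<in> S \<Longrightarrow> (\<And>\<delta>. \<delta> \<in> cart_power \<Delta> l \<Longrightarrow> g \<delta> = f \<delta>) \<Longrightarrow> g \<in> S"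
    and zero: "(\<lambda>_. 0) \<in> S"
    and add: "f \<in> S \<Longrightarrow> g \<in> S \<Longrightarrow> (\<lambda>\<delta>. f \<delta> + g \<delta>) \<in> S"
    and scale: "f \<in> S \<Longrightarrow> (\<lambda>\<delta>. c * f \<delta>) \<in> S"
    and act: "f \<in> S \<Longrightarrow> h \<in> {1..l} \<rightarrow>\<^sub>E Bij \<Delta> \<Longrightarrow> \<sigma> permutes {1..l} \<Longrightarrow>
      (\<lambda>\<delta>. f (product_action \<Delta> l (h, \<sigma>) \<delta>)) \<in> S"

text \<open>
  The tensor product of the functions \<open>e\<^bsub>\<alpha> i\<^esub> - e\<^bsub>\<beta> i\<^esub>\<close> in the coordinates \<open>i \<in> I\<close> and of the
  constant \<open>1\<close> in all others.
\<close>

definition diff_prod :: "nat set \<Rightarrow> (nat \<Rightarrow> 'a) \<Rightarrow> (nat \<Rightarrow> 'a) \<Rightarrow> (nat \<Rightarrow> 'a) \<Rightarrow> 'f::comm_ring_1" where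
  "diff_prod I \<alpha> \<beta> \<delta> = (\<Prod>i\<in>I. of_bool (\<delta> i = \<alpha> i) - of_bool (\<delta> i = \<beta> i))"

lemma diff_prod_insert:
  assumes "finite I" "j \<notin> I"
  shows "(diff_prod (insert j I) (\<alpha>(j := a)) (\<beta>(j := b)) \<delta> :: 'f::comm_ring_1) =
    (of_bool (\<delta> j = a) - of_bool (\<delta> j = b)) * diff_prod I \<alpha> \<beta> \<delta>"
proof -
  have "(\<Prod>i\<in>I. of_bool (\<delta> i = (\<alpha>(j := a)) i) - of_bool (\<delta> i = (\<beta>(j := b)) i)) = (diff_prod I \<alpha> \<beta> \<delta> :: 'f)"
    unfolding diff_prod_def by (rule prod.cong) (use assms in auto)
  then show ?thesis using assms by (simp add: diff_prod_def)
qed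

lemma diff_prod_upd:
  "j \<notin> I \<Longrightarrow> diff_prod I \<alpha> \<beta> (\<delta>(j := a)) = diff_prod I \<alpha> \<beta> \<delta>"
  unfolding diff_prod_def by (rule prod.cong) auto

lemma constant_if_coordinatewise_constant:
  assumes c: "\<And>j \<delta> a. j \<in> {1..l} \<Longrightarrow> \<delta> \<in> cart_power \<Delta> l \<Longrightarrow> a \<in> \<Delta> \<Longrightarrow> h (\<delta>(j := a)) = h \<delta>"
    and d: "\<delta> \<in> cart_power \<Delta> l" "\<epsilon> \<in> cart_power \<Delta> l"
  shows "h \<epsilon> = h \<delta>"
proof -
  \<comment> \<open>Walk from \<open>\<delta>\<close> to \<open>\<epsilon>\<close>, changing one coordinate at a time.\<close>
  have "n \<le> l \<Longrightarrow> h (\<lambda>i. if i \<le> n then \<epsilon> i else \<delta> i) = h \<delta>" for n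
  proof (induction n)
    case 0
    have "(\<lambda>i. if i \<le> 0 then \<epsilon> i else \<delta> i) = \<delta>"
      using d by (auto simp: PiE_iff extensional_def)
    then show ?case by simp
  next
    case (Suc n)
    have "(\<lambda>i. if i \<le> Suc n then \<epsilon> i else \<delta> i) = (\<lambda>i. if i \<le> n then \<epsilon> i else \<delta> i)(Suc n := \<epsilon> (Suc n))"
      by (auto simp: le_Suc_eq)
    moreover have "(\<lambda>i. if i \<le> n then \<epsilon> i else \<delta> i) \<in> cart_power \<Delta> l"
      using d by (auto simp: PiE_iff extensional_def)
    ultimately show ?case using Suc c d by (auto simp: PiE_iff)
  qed
  moreover have "(\<lambda>i. if i \<le> l then \<epsilon> i else \<delta> i) = \<epsilon>"
    using d by (auto simp: PiE_iff extensional_def)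
  ultimately show ?thesis by (metis order_refl)
qed

lemma Bij_mapping_pair:
  assumes "x \<in> \<Delta>" "y \<in> \<Delta>" "x' \<in> \<Delta>" "y' \<in> \<Delta>" "x \<noteq> y" "x' \<noteq> y'"
  obtains h where "h \<in> Bij \<Delta>" "h x = x'" "h y = y'"
proof -
  let ?y = "transpose x x' y"
  let ?p = "transpose ?y y' \<circ> transpose x x'"
  have yD: "?y \<in> \<Delta>" using assms by (auto simp: transpose_def)
  have p: "?p permutes \<Delta>"
    using assms yD by (intro permutes_compose permutes_swap_id)
  have ne: "?y \<noteq> x'" using assms by (auto simp: transpose_def split: if_splits)
  show thesis
  proof (rule that[of "restrict ?p \<Delta>"])
    show "restrict ?p \<Delta> \<in> Bij \<Delta>"
      using permutes_imp_bij[OF p] by (simp add: Bij_def bij_betw_restrict_eq)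
    show "restrict ?p \<Delta> x = x'" "restrict ?p \<Delta> y = y'"
      using assms ne by auto
  qed
qed

lemma permutation_mapping_subset:
  assumes "finite A" "I \<subseteq> A" "J \<subseteq> A" "card I = card J"
  obtains \<sigma> where "\<sigma> permutes A" "bij_betw \<sigma> I J"
proof -
  have fin: "finite I" "finite J" using assms finite_subset by auto
  obtain f where f: "bij_betw f I J" using finite_same_card_bij[OF fin assms(4)] ..
  have "card (A - I) = card (A - J)" using assms fin by (simp add: card_Diff_subset)
  then obtain g where g: "bij_betw g (A - I) (A - J)"
    using finite_same_card_bij[of "A - I" "A - J"] assms(1) by auto
  define \<sigma> where "\<sigma> i = (if i \<in> I then f i else if i \<in> A then g i else i)" for i
  have sI: "bij_betw \<sigma> I J"
    by (rule bij_betw_cong[THEN iffD2, OF _ f]) (simp add: \<sigma>_def)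
  moreover have "bij_betw \<sigma> (A - I) (A - J)"
    by (rule bij_betw_cong[THEN iffD2, OF _ g]) (simp add: \<sigma>_def)
  ultimately have "bij_betw \<sigma> (I \<union> (A - I)) (J \<union> (A - J))"
    by (rule bij_betw_combine) auto
  then have "bij_betw \<sigma> A A" using assms by (simp add: Un_absorb1)
  then have "\<sigma> permutes A" by (rule bij_imp_permutes) (use assms in \<open>auto simp: \<sigma>_def\<close>)
  then show thesis using sI that by blast
qed

context invariant_functions
begin

lemma sum_mem: "(\<And>a. a \<in> A \<Longrightarrow> f a \<in> S) \<Longrightarrow> (\<lambda>\<delta>. \<Sum>a\<in>A. f a \<delta>) \<in> S"
  by (induction A rule: infinite_finite_induct) (use zero add in auto)

lemma diff_mem:
  assumes "f \<in> S" "g \<in> S"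
  shows "(\<lambda>\<delta>. f \<delta> - g \<delta>) \<in> S"
  using add[OF assms(1) scale[OF assms(2), of "-1"]] by simp

lemma swap_mem:
  assumes "f \<in> S" "j \<in> {1..l}" "a \<in> \<Delta>" "b \<in> \<Delta>"
  shows "(\<lambda>\<delta>. f (\<delta>(j := transpose a b (\<delta> j)))) \<in> S"
proof -
  define h where "h = (\<lambda>i\<in>{1..l}. if i = j then restrict (transpose a b) \<Delta> else (\<lambda>x\<in>\<Delta>. x))"
  have "restrict (transpose a b) \<Delta> \<in> Bij \<Delta>"
    using permutes_imp_bij[OF permutes_swap_id[OF assms(3,4)]] by (simp add: Bij_def)
  then have "h \<in> {1..l} \<rightarrow>\<^sub>E Bij \<Delta>"
    using id_Bij[of \<Delta>] by (auto simp: h_def)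
  then have "(\<lambda>\<delta>. f (product_action \<Delta> l (h, id) \<delta>)) \<in> S"
    by (intro act assms permutes_id)
  then show ?thesis
  proof (rule cong)
    fix \<delta> assume d: "\<delta> \<in> cart_power \<Delta> l"
    have "product_action \<Delta> l (h, id) \<delta> = \<delta>(j := transpose a b (\<delta> j))"
      using d assms(2) by (auto simp: product_action_def h_def PiE_iff extensional_def)
    then show "f (\<delta>(j := transpose a b (\<delta> j))) = f (product_action \<Delta> l (h, id) \<delta>)" by simp
  qed
qed

text \<open>
  Applying \<open>1 - (a b)\<close> in the coordinate \<open>j\<close>: the result vanishes unless \<open>\<delta> j\<close> is \<open>a\<close> or \<open>b\<close>,
  and it takes opposite values at these two. So it has the factor \<open>e\<^sub>a - e\<^sub>b\<close>, and the
  remaining factor, a difference of two specialisations of \<open>h\<close>, no longer depends on the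
  coordinate \<open>j\<close>.
\<close>

lemma difference_mem:
  assumes mem: "(\<lambda>\<delta>. diff_prod I \<alpha> \<beta> \<delta> * h \<delta>) \<in> S" and "finite I"
    and j: "j \<in> {1..l}" "j \<notin> I" and ab: "a \<in> \<Delta>" "b \<in> \<Delta>" "a \<noteq> b"
  shows "(\<lambda>\<delta>. diff_prod (insert j I) (\<alpha>(j := a)) (\<beta>(j := b)) \<delta> * (h (\<delta>(j := a)) - h (\<delta>(j := b)))) \<in> S"
proof (rule cong[OF diff_mem[OF mem swap_mem[OF mem j(1) ab(1,2)]]])
  fix \<delta> :: "nat \<Rightarrow> 'a"
  have "\<delta>(j := a) = \<delta>" if "\<delta> j = a" for a using that by auto
  then show "diff_prod (insert j I) (\<alpha>(j := a)) (\<beta>(j := b)) \<delta> * (h (\<delta>(j := a)) - h (\<delta>(j := b))) =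
      diff_prod I \<alpha> \<beta> \<delta> * h \<delta> -
      diff_prod I \<alpha> \<beta> (\<delta>(j := transpose a b (\<delta> j))) * h (\<delta>(j := transpose a b (\<delta> j)))"
    unfolding diff_prod_insert[OF assms(2) j(2)] diff_prod_upd[OF j(2)]
    using ab by (auto simp: transpose_def algebra_simps)
qed

text \<open>
  As long as \<open>h\<close> depends on some coordinate \<open>j\<close> outside \<open>I\<close>, the previous lemma enlarges \<open>I\<close> by
  \<open>j\<close> and replaces \<open>h\<close> by another function that is nonzero at some point of \<open>\<Delta>\<^sup>l\<close>. When this is
  no longer possible, \<open>h\<close> is a nonzero constant and can be divided out.
\<close>

lemma exists_diff_prod_mem:
  assumes "I \<subseteq> {1..l}" "\<And>i. i \<in> I \<Longrightarrow> \<alpha> i \<in> \<Delta> \<and> \<beta> i \<in> \<Delta> \<and> \<alpha> i \<noteq> \<beta> i"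
    and "(\<lambda>\<delta>. diff_prod I \<alpha> \<beta> \<delta> * h \<delta>) \<in> S"
    and "\<And>i \<delta> x. i \<in> I \<Longrightarrow> h (\<delta>(i := x)) = h \<delta>"
    and "\<delta>\<^sub>0 \<in> cart_power \<Delta> l" "h \<delta>\<^sub>0 \<noteq> 0"
  shows "\<exists>I' \<alpha>' \<beta>'. I \<subseteq> I' \<and> I' \<subseteq> {1..l} \<and> (\<forall>i\<in>I'. \<alpha>' i \<in> \<Delta> \<and> \<beta>' i \<in> \<Delta> \<and> \<alpha>' i \<noteq> \<beta>' i) \<and>
    diff_prod I' \<alpha>' \<beta>' \<in> S"
  using assms
proof (induction "card ({1..l} - I)" arbitrary: I \<alpha> \<beta> h \<delta>\<^sub>0 rule: less_induct)
  case less
  have fin: "finite I" using less.prems(1) finite_subset by blast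
  show ?case
  proof (cases "\<exists>j\<in>{1..l} - I. \<exists>a\<in>\<Delta>. \<exists>\<delta>\<in>cart_power \<Delta> l. h (\<delta>(j := a)) \<noteq> h \<delta>")
    case True
    then obtain j a \<delta> where j: "j \<in> {1..l}" "j \<notin> I" and a: "a \<in> \<Delta>" and d: "\<delta> \<in> cart_power \<Delta> l"
      and ne: "h (\<delta>(j := a)) \<noteq> h \<delta>" by blast
    define b where "b = \<delta> j"
    have b: "b \<in> \<Delta>" using d j by (auto simp: b_def)
    have db: "\<delta>(j := b) = \<delta>" by (simp add: b_def)
    have ab: "a \<noteq> b" using ne db by auto
    let ?h = "\<lambda>\<delta>. h (\<delta>(j := a)) - h (\<delta>(j := b))"
    have sm: "card ({1..l} - insert j I) < card ({1..l} - I)"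
    proof (rule psubset_card_mono)
      show "{1..l} - insert j I \<subset> {1..l} - I" using j by blast
    qed simp
    have sub: "insert j I \<subseteq> {1..l}" using j less.prems(1) by blast
    have ne': "\<And>i. i \<in> insert j I \<Longrightarrow>
        (\<alpha>(j := a)) i \<in> \<Delta> \<and> (\<beta>(j := b)) i \<in> \<Delta> \<and> (\<alpha>(j := a)) i \<noteq> (\<beta>(j := b)) i"
      using a b ab less.prems(2) by auto
    have mem: "(\<lambda>\<delta>. diff_prod (insert j I) (\<alpha>(j := a)) (\<beta>(j := b)) \<delta> * ?h \<delta>) \<in> S"
      by (rule difference_mem[OF less.prems(3) fin j a b ab])
    have indep: "?h (\<delta>(i := x)) = ?h \<delta>" if "i \<in> insert j I" for i \<delta> x
    proof (cases "i = j")
      case False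
      then have "i \<in> I" using that by blast
      then show ?thesis
        by (simp only: fun_upd_twist[OF False] less.prems(4))
    qed simp
    have "?h \<delta> \<noteq> 0" using ne db by simp
    from less.hyps[OF sm sub ne' mem indep d this] show ?thesis by (meson insert_subset)
  next
    case False
    have "h \<delta> = h \<delta>\<^sub>0" if "\<delta> \<in> cart_power \<Delta> l" for \<delta>
      by (rule constant_if_coordinatewise_constant[OF _ less.prems(5) that])
        (use False less.prems(4) in blast)
    then have "diff_prod I \<alpha> \<beta> \<in> S"
      by (intro cong[OF scale[OF less.prems(3), of "inverse (h \<delta>\<^sub>0)"]]) (use less.prems(6) in simp)
    then show ?thesis using less.prems(1,2) by blast
  qed
qed

text \<open>
  A single group element does the transfer: a permutation \<open>\<sigma>\<close> of the coordinates that maps \<open>J\<close>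
  onto \<open>I\<close>, and in each coordinate of \<open>I\<close> a bijection of \<open>\<Delta>\<close> that sends the new pair of points to
  the old one. Allowing \<open>\<alpha>' i = \<beta>' i\<close>, where the product is zero, keeps later sums free of side
  conditions.
\<close>

lemma diff_prod_mem_transfer:
  assumes mem: "diff_prod I \<alpha> \<beta> \<in> S" and I: "I \<subseteq> {1..l}"
    and ab: "\<And>i. i \<in> I \<Longrightarrow> \<alpha> i \<in> \<Delta> \<and> \<beta> i \<in> \<Delta> \<and> \<alpha> i \<noteq> \<beta> i"
    and J: "J \<subseteq> {1..l}" "card J = card I"
    and ab': "\<alpha>' \<in> J \<rightarrow> \<Delta>" "\<beta>' \<in> J \<rightarrow> \<Delta>"
  shows "diff_prod J \<alpha>' \<beta>' \<in> S"
proof (cases "\<exists>i\<in>J. \<alpha>' i = \<beta>' i")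
  case True
  moreover have "finite J" using J(1) finite_subset by blast
  ultimately have "diff_prod J \<alpha>' \<beta>' = (\<lambda>_. 0 :: 'f)"
    by (force simp: diff_prod_def fun_eq_iff intro: prod_zero)
  then show ?thesis using zero by simp
next
  case False
  obtain \<sigma> where s: "\<sigma> permutes {1..l}" and sJ: "bij_betw \<sigma> J I"
    using permutation_mapping_subset[of "{1..l}" J I] I J by auto
  have "\<exists>h. h \<in> Bij \<Delta> \<and> (i \<in> I \<longrightarrow> h (\<alpha>' (inv' \<sigma> i)) = \<alpha> i \<and> h (\<beta>' (inv' \<sigma> i)) = \<beta> i)" for i
  proof (cases "i \<in> I")
    case True
    then obtain j where j: "j \<in> J" "i = \<sigma> j" using sJ by (auto simp: bij_betw_def)
    then have "inv' \<sigma> i = j" using permutes_inverses(2)[OF s] by simp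
    moreover obtain h where "h \<in> Bij \<Delta>" "h (\<alpha>' j) = \<alpha> i" "h (\<beta>' j) = \<beta> i"
      using Bij_mapping_pair[of "\<alpha>' j" \<Delta> "\<beta>' j" "\<alpha> i" "\<beta> i"] ab[OF True] ab' j False by blast
    ultimately show ?thesis by blast
  qed (use id_Bij in blast)
  then obtain h where h: "\<And>i. h i \<in> Bij \<Delta>"
    "\<And>i. i \<in> I \<Longrightarrow> h i (\<alpha>' (inv' \<sigma> i)) = \<alpha> i \<and> h i (\<beta>' (inv' \<sigma> i)) = \<beta> i"
    by metis
  have "(\<lambda>\<delta>. diff_prod I \<alpha> \<beta> (product_action \<Delta> l (restrict h {1..l}, \<sigma>) \<delta>)) \<in> S"
    using h(1) by (intro act mem s) auto
  then show ?thesis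
  proof (rule cong)
    fix \<delta> assume d: "\<delta> \<in> cart_power \<Delta> l"
    have eq: "(h (\<sigma> j) (\<delta> j) = h (\<sigma> j) x) = (\<delta> j = x)" if "j \<in> J" "x \<in> \<Delta>" for j x
      using h(1)[of "\<sigma> j"] that d J by (auto simp: Bij_def bij_betw_def PiE_iff dest: inj_onD)
    have "(diff_prod I \<alpha> \<beta> (product_action \<Delta> l (restrict h {1..l}, \<sigma>) \<delta>) :: 'f) =
        (\<Prod>i\<in>I. of_bool (h i (\<delta> (inv' \<sigma> i)) = \<alpha> i) - of_bool (h i (\<delta> (inv' \<sigma> i)) = \<beta> i))"
      unfolding diff_prod_def by (rule prod.cong) (use d I in \<open>auto simp: product_action_def subset_iff\<close>)
    also have "\<dots> = (\<Prod>j\<in>J. of_bool (h (\<sigma> j) (\<delta> j) = \<alpha> (\<sigma> j)) - of_bool (h (\<sigma> j) (\<delta> j) = \<beta> (\<sigma> j)))"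
      using permutes_inverses(2)[OF s] by (simp flip: prod.reindex_bij_betw[OF sJ])
    also have "\<dots> = (diff_prod J \<alpha>' \<beta>' \<delta> :: 'f)"
      unfolding diff_prod_def
    proof (rule prod.cong[OF refl])
      fix j assume j: "j \<in> J"
      then have "\<sigma> j \<in> I" using sJ by (auto simp: bij_betw_def)
      then have "\<alpha> (\<sigma> j) = h (\<sigma> j) (\<alpha>' j)" "\<beta> (\<sigma> j) = h (\<sigma> j) (\<beta>' j)"
        using h(2)[of "\<sigma> j"] permutes_inverses(2)[OF s] by simp_all
      moreover have "\<alpha>' j \<in> \<Delta>" "\<beta>' j \<in> \<Delta>" using ab' j by auto
      ultimately show "of_bool (h (\<sigma> j) (\<delta> j) = \<alpha> (\<sigma> j)) - of_bool (h (\<sigma> j) (\<delta> j) = \<beta> (\<sigma> j)) =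
          (of_bool (\<delta> j = \<alpha>' j) - of_bool (\<delta> j = \<beta>' j) :: 'f)"
        using eq[OF j] by simp
    qed
    finally show "(diff_prod J \<alpha>' \<beta>' \<delta> :: 'f) = diff_prod I \<alpha> \<beta> (product_action \<Delta> l (restrict h {1..l}, \<sigma>) \<delta>)" ..
  qed
qed

definition contains_degree :: "nat \<Rightarrow> bool" where
  "contains_degree m \<longleftrightarrow> (\<forall>I \<alpha> \<beta>. I \<subseteq> {1..l} \<longrightarrow> card I = m \<longrightarrow> \<alpha> \<in> I \<rightarrow> \<Delta> \<longrightarrow> \<beta> \<in> I \<rightarrow> \<Delta> \<longrightarrow>
     diff_prod I \<alpha> \<beta> \<in> S)"

lemma contains_some_degree:
  assumes "f \<in> S" "\<delta> \<in> cart_power \<Delta> l" "\<epsilon> \<in> cart_power \<Delta> l" "f \<delta> \<noteq> f \<epsilon>"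
  obtains m where "1 \<le> m" "m \<le> l" "contains_degree m"
proof -
  have "\<exists>j\<in>{1..l}. \<exists>\<gamma>\<in>cart_power \<Delta> l. \<exists>a\<in>\<Delta>. f (\<gamma>(j := a)) \<noteq> f \<gamma>"
  proof (rule ccontr)
    assume "\<not> ?thesis"
    then have "f \<delta> = f \<epsilon>"
      by (intro constant_if_coordinatewise_constant[where h = f, OF _ assms(3,2)]) auto
    then show False using assms(4) by simp
  qed
  then obtain j \<gamma> a where j: "j \<in> {1..l}" and g: "\<gamma> \<in> cart_power \<Delta> l" and a: "a \<in> \<Delta>"
    and ne: "f (\<gamma>(j := a)) \<noteq> f \<gamma>" by blast
  define b where "b = \<gamma> j"
  have b: "b \<in> \<Delta>" using g j by (auto simp: b_def)
  have gb: "\<gamma>(j := b) = \<gamma>" by (simp add: b_def)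
  have ab: "a \<noteq> b" using ne gb by auto
  let ?h = "\<lambda>\<delta>. f (\<delta>(j := a)) - f (\<delta>(j := b))"
  let ?\<alpha> = "(\<lambda>_. a)(j := a)" and ?\<beta> = "(\<lambda>_. b)(j := b)"
  have "(\<lambda>\<delta>. diff_prod {} (\<lambda>_. a) (\<lambda>_. b) \<delta> * f \<delta>) \<in> S"
    using assms(1) by (simp add: diff_prod_def)
  from difference_mem[OF this _ j _ a b ab]
  have mem: "(\<lambda>\<delta>. diff_prod {j} ?\<alpha> ?\<beta> \<delta> * ?h \<delta>) \<in> S" by simp
  have "?h (\<delta>(i := x)) = ?h \<delta>" if "i \<in> {j}" for i \<delta> x
    using that by simp
  moreover have "?h \<gamma> \<noteq> 0" using ne gb by simp
  ultimately have "\<exists>I \<alpha> \<beta>. {j} \<subseteq> I \<and> I \<subseteq> {1..l} \<and> (\<forall>i\<in>I. \<alpha> i \<in> \<Delta> \<and> \<beta> i \<in> \<Delta> \<and> \<alpha> i \<noteq> \<beta> i) \<and>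
      diff_prod I \<alpha> \<beta> \<in> S"
    by (intro exists_diff_prod_mem[OF _ _ mem _ g]) (use j a b ab in simp_all)
  then obtain I \<alpha> \<beta> where I: "{j} \<subseteq> I" "I \<subseteq> {1..l}" "diff_prod I \<alpha> \<beta> \<in> S"
    "\<And>i. i \<in> I \<Longrightarrow> \<alpha> i \<in> \<Delta> \<and> \<beta> i \<in> \<Delta> \<and> \<alpha> i \<noteq> \<beta> i" by blast
  have "finite I" using finite_subset[OF I(2)] by simp
  then have "1 \<le> card I" using card_mono[OF _ I(1)] by simp
  moreover have "card I \<le> l" using card_mono[OF _ I(2)] by simp
  moreover have "contains_degree (card I)"
    unfolding contains_degree_def by (intro allI impI diff_prod_mem_transfer[OF I(3,2,4)])
  ultimately show thesis by (rule that)
qed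

text \<open>
  If \<open>k = 0\<close> in the field, then \<open>\<Sum>a. (e\<^sub>a - e\<^sub>b) = 1 - k e\<^sub>b = 1\<close>, so summing over the first
  point of the pair in the coordinate \<open>j\<close> removes the factor at \<open>j\<close>.
\<close>

lemma contains_lower_degree:
  assumes k: "of_nat (card \<Delta>) = (0 :: 'f)" and "\<Delta> \<noteq> {}"
    and "contains_degree (Suc n)" "Suc n \<le> l"
  shows "contains_degree n"
  unfolding contains_degree_def
proof (intro allI impI)
  fix I \<alpha> \<beta> assume I: "I \<subseteq> {1..l}" "card I = n" and ab: "\<alpha> \<in> I \<rightarrow> \<Delta>" "\<beta> \<in> I \<rightarrow> \<Delta>"
  obtain b where b: "b \<in> \<Delta>" using assms(2) by blast
  have fin: "finite I" using I(1) finite_subset by blast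
  have "\<not> {1..l} \<subseteq> I" using I(2) assms(4) card_mono[OF fin, of "{1..l}"] by auto
  then obtain j where j: "j \<in> {1..l}" "j \<notin> I" by blast
  have "diff_prod (insert j I) (\<alpha>(j := a)) (\<beta>(j := b)) \<in> S" if "a \<in> \<Delta>" for a
  proof -
    have "insert j I \<subseteq> {1..l}" "card (insert j I) = Suc n"
      "\<alpha>(j := a) \<in> insert j I \<rightarrow> \<Delta>" "\<beta>(j := b) \<in> insert j I \<rightarrow> \<Delta>"
      using I j fin ab that b by auto
    then show ?thesis using assms(3) unfolding contains_degree_def by blast
  qed
  then have "(\<lambda>\<delta>. \<Sum>a\<in>\<Delta>. diff_prod (insert j I) (\<alpha>(j := a)) (\<beta>(j := b)) \<delta>) \<in> S"
    by (rule sum_mem)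
  then show "diff_prod I \<alpha> \<beta> \<in> S"
  proof (rule cong)
    fix \<delta> assume "\<delta> \<in> cart_power \<Delta> l"
    then have "\<delta> j \<in> \<Delta>" using j by auto
    then have "(\<Sum>a\<in>\<Delta>. of_bool (\<delta> j = a) - of_bool (\<delta> j = b)) = (1 :: 'f)"
      using finite_\<Delta> k by (simp add: sum_subtractf of_bool_def)
    then have "diff_prod I \<alpha> \<beta> \<delta> =
        (\<Sum>a\<in>\<Delta>. of_bool (\<delta> j = a) - of_bool (\<delta> j = b)) * (diff_prod I \<alpha> \<beta> \<delta> :: 'f)"
      by (simp only: mult_1)
    also have "\<dots> = (\<Sum>a\<in>\<Delta>. diff_prod (insert j I) (\<alpha>(j := a)) (\<beta>(j := b)) \<delta>)"
      by (simp only: diff_prod_insert[OF fin j(2)] sum_distrib_right)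
    finally show "(diff_prod I \<alpha> \<beta> \<delta> :: 'f) =
        (\<Sum>a\<in>\<Delta>. diff_prod (insert j I) (\<alpha>(j := a)) (\<beta>(j := b)) \<delta>)" .
  qed
qed

end


section \<open>Counting independent functions\<close>

lemma mult_le_choose_mult_power:
  assumes "1 \<le> m" "m \<le> l" "2 \<le> (q::nat)"
  shows "l * q \<le> (l choose m) * q ^ m"
proof -
  \<comment> \<open>After cancelling one factor \<open>q\<close>, the worst case is \<open>q = 2\<close>, where Pascal's rule gives an induction.\<close>
  have *: "l \<le> (l choose m) * 2 ^ (m - 1)" if "1 \<le> m" "m \<le> l" for l m
    using that
  proof (induction l arbitrary: m)
    case (Suc l)
    show ?case
    proof (cases "m = 1")
      case False
      then obtain n where n: "m = Suc n" "1 \<le> n" using Suc.prems by (cases m) auto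
      have "Suc l \<le> 2 * l" using Suc.prems n by simp
      also have "\<dots> \<le> 2 * ((l choose n) * 2 ^ (n - 1))" using Suc n by simp
      also have "\<dots> = (l choose n) * 2 ^ n" using n by (cases n) auto
      also have "\<dots> \<le> (Suc l choose m) * 2 ^ (m - 1)" using n by simp
      finally show ?thesis .
    qed simp
  qed simp
  have "l * q \<le> (l choose m) * 2 ^ (m - 1) * q" using * assms by simp
  also have "\<dots> \<le> (l choose m) * q ^ (m - 1) * q"
    using assms by (intro mult_right_mono mult_left_mono power_mono) auto
  also have "\<dots> = (l choose m) * q ^ m" using assms by (cases m) auto
  finally show ?thesis .
qed

text \<open>
  The products are those with \<open>\<beta>\<close> constantly \<open>b\<close>, indexed by the pairs of a set \<open>I\<close> of size
  \<open>m\<close> and a function \<open>\<alpha>\<close> from \<open>I\<close> to \<open>\<Delta> - {b}\<close>. In one variable, the basis consisting of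
  \<open>1\<close> and the \<open>e\<^sub>a - e\<^sub>b\<close> has as its dual basis the mean \<open>f \<mapsto> 1/k \<Sum>x. f x\<close> and the functionals
  \<open>f \<mapsto> f a - 1/k \<Sum>x. f x\<close>; the weights used here are the tensor products of these.
\<close>

lemma edim_ge_if_contains_degree:
  fixes scale :: "'f::field \<Rightarrow> 'v::ab_group_add \<Rightarrow> 'v"
  assumes vs: "vector_space scale" and sub: "module.subspace scale V"
    and phi: "\<phi> \<in> cart_power \<Delta> l \<rightarrow> V"
    and inv: "invariant_functions \<Delta> l (pulled_back_functionals scale V (cart_power \<Delta> l) \<phi>)"
    and deg: "invariant_functions.contains_degree \<Delta> l
      (pulled_back_functionals scale V (cart_power \<Delta> l) \<phi>) m"
    and m: "1 \<le> m" "m \<le> l" and k: "of_nat (card \<Delta>) \<noteq> (0 :: 'f)" and k3: "card \<Delta> \<ge> 3"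
  shows "enat ((card \<Delta> - 1) * l) \<le> edim scale V"
proof -
  interpret invariant_functions \<Delta> l "pulled_back_functionals scale V (cart_power \<Delta> l) \<phi>" by (rule inv)
  obtain b where b: "b \<in> \<Delta>" using k3 by fastforce
  define J where "J = (SIGMA I:{I. I \<subseteq> {1..l} \<and> card I = m}. I \<rightarrow>\<^sub>E \<Delta> - {b})"
  define r where "r = inverse (of_nat (card \<Delta>) :: 'f)"
  define u where "u I \<alpha> i x = (if i \<in> I then of_bool (x = \<alpha> i) - of_bool (x = b) else 1 :: 'f)"
    for I :: "nat set" and \<alpha> i and x :: 'a
  define v where "v I \<alpha> i x = (if i \<in> I then of_bool (x = \<alpha> i) - r else r)"
    for I :: "nat set" and \<alpha> i and x :: 'a
  have finI: "finite I" if "I \<subseteq> {1..l}" for I using finite_subset[OF that] by simp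
  have "card J = (\<Sum>I\<in>{I. I \<subseteq> {1..l} \<and> card I = m}. card (I \<rightarrow>\<^sub>E \<Delta> - {b}))"
    unfolding J_def using finI finite_\<Delta> by (intro card_SigmaI) (auto intro!: finite_PiE)
  also have "\<dots> = (\<Sum>I\<in>{I. I \<subseteq> {1..l} \<and> card I = m}. (card \<Delta> - 1) ^ m)"
    by (rule sum.cong[OF refl]) (use finI finite_\<Delta> b in \<open>auto simp: card_PiE\<close>)
  also have "\<dots> = (l choose m) * (card \<Delta> - 1) ^ m"
    using n_subsets[of "{1..l}" m] by simp
  finally have "(card \<Delta> - 1) * l \<le> card J"
    using mult_le_choose_mult_power[OF m, of "card \<Delta> - 1"] k3 by (simp add: mult.commute)
  moreover have "enat (card J) \<le> edim scale V"
  proof (rule biorthogonal_card_le_edim[OF vs sub phi, where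
        g = "\<lambda>(I, \<alpha>) \<delta>. diff_prod I \<alpha> (\<lambda>_. b) \<delta>" and K = "\<lambda>(I, \<alpha>) \<delta>. \<Prod>i\<in>{1..l}. v I \<alpha> i (\<delta> i)"])
    show "finite J"
      unfolding J_def using finI finite_\<Delta> by (auto intro!: finite_SigmaI finite_PiE)
    show "(case j of (I, \<alpha>) \<Rightarrow> \<lambda>\<delta>. diff_prod I \<alpha> (\<lambda>_. b) \<delta>) \<in>
        pulled_back_functionals scale V (cart_power \<Delta> l) \<phi>" if jJ: "j \<in> J" for j
    proof -
      obtain I \<alpha> where j: "j = (I, \<alpha>)" "I \<subseteq> {1..l}" "card I = m" "\<alpha> \<in> I \<rightarrow>\<^sub>E \<Delta> - {b}"
        using jJ unfolding J_def by (cases j) auto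
      then have "\<alpha> \<in> I \<rightarrow> \<Delta>" "(\<lambda>_. b) \<in> I \<rightarrow> \<Delta>" using b by auto
      then show ?thesis using deg j unfolding contains_degree_def by auto
    qed
    fix p q assume "p \<in> J" "q \<in> J"
    then obtain I \<alpha> I' \<alpha>' where p: "p = (I, \<alpha>)" "I \<subseteq> {1..l}" "\<alpha> \<in> I \<rightarrow>\<^sub>E \<Delta> - {b}"
      and q: "q = (I', \<alpha>')" "I' \<subseteq> {1..l}" "\<alpha>' \<in> I' \<rightarrow>\<^sub>E \<Delta> - {b}"
      unfolding J_def by (cases p; cases q) auto
    have du: "diff_prod I' \<alpha>' (\<lambda>_. b) \<delta> = (\<Prod>i\<in>{1..l}. u I' \<alpha>' i (\<delta> i))" for \<delta>
      unfolding diff_prod_def u_def using q(2) by (subst prod.If_cases) (auto simp: Int_absorb1)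
    have uv: "(\<Sum>x\<in>\<Delta>. v I \<alpha> i x * u I' \<alpha>' i x) =
        of_bool ((i \<in> I \<longleftrightarrow> i \<in> I') \<and> (i \<in> I \<longrightarrow> \<alpha> i = \<alpha>' i))" for i
    proof -
      have s1: "(\<Sum>x\<in>\<Delta>. of_bool (x = c)) = (1 :: 'f)" if "c \<in> \<Delta>" for c
        using finite_\<Delta> that by (simp add: of_bool_def)
      have s2: "(\<Sum>x\<in>\<Delta>. of_bool (x = c) * of_bool (x = d)) = (of_bool (c = d) :: 'f)" if "c \<in> \<Delta>" for c d
      proof -
        have "(\<Sum>x\<in>\<Delta>. of_bool (x = c) * of_bool (x = d)) = (\<Sum>x\<in>\<Delta>. if x = c then of_bool (c = d) else 0 :: 'f)"
          by (rule sum.cong) auto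
        then show ?thesis using finite_\<Delta> that by simp
      qed
      have a: "i \<in> I \<Longrightarrow> \<alpha> i \<in> \<Delta> \<and> \<alpha> i \<noteq> b" "i \<in> I' \<Longrightarrow> \<alpha>' i \<in> \<Delta>"
        using p q by (auto simp: PiE_iff)
      consider "i \<in> I" "i \<in> I'" | "i \<in> I" "i \<notin> I'" | "i \<notin> I" "i \<in> I'" | "i \<notin> I" "i \<notin> I'" by blast
      then show ?thesis
      proof cases
        case 1
        then have "(\<Sum>x\<in>\<Delta>. v I \<alpha> i x * u I' \<alpha>' i x) =
          (\<Sum>x\<in>\<Delta>. of_bool (x = \<alpha> i) * of_bool (x = \<alpha>' i)) - (\<Sum>x\<in>\<Delta>. of_bool (x = \<alpha> i) * of_bool (x = b))
          - r * ((\<Sum>x\<in>\<Delta>. of_bool (x = \<alpha>' i)) - (\<Sum>x\<in>\<Delta>. of_bool (x = b)))"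
          unfolding u_def v_def sum_subtractf[symmetric] sum_distrib_left
          by (intro sum.cong) (auto simp: algebra_simps)
        then show ?thesis using 1 a b by (simp only: s1 s2) simp
      next
        case 2
        then show ?thesis using a k s1 by (simp add: u_def v_def sum_subtractf r_def)
      next
        case 3
        then show ?thesis using a b s1
          by (simp add: u_def v_def sum_subtractf flip: sum_distrib_left)
      next
        case 4
        then show ?thesis using k by (simp add: u_def v_def r_def)
      qed
    qed
    have "(\<Sum>\<delta>\<in>cart_power \<Delta> l. (\<Prod>i\<in>{1..l}. v I \<alpha> i (\<delta> i)) * diff_prod I' \<alpha>' (\<lambda>_. b) \<delta>) =
        (\<Sum>\<delta>\<in>cart_power \<Delta> l. \<Prod>i\<in>{1..l}. v I \<alpha> i (\<delta> i) * u I' \<alpha>' i (\<delta> i))"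
      unfolding du prod.distrib ..
    also have "\<dots> = (\<Prod>i\<in>{1..l}. \<Sum>x\<in>\<Delta>. v I \<alpha> i x * u I' \<alpha>' i x)"
      using finite_\<Delta> by (subst prod_sum_PiE) auto
    also have "\<dots> = of_bool (\<forall>i\<in>{1..l}. (i \<in> I \<longleftrightarrow> i \<in> I') \<and> (i \<in> I \<longrightarrow> \<alpha> i = \<alpha>' i))"
      unfolding uv by (auto simp: intro!: prod_zero)
    also have "(\<forall>i\<in>{1..l}. (i \<in> I \<longleftrightarrow> i \<in> I') \<and> (i \<in> I \<longrightarrow> \<alpha> i = \<alpha>' i)) \<longleftrightarrow> p = q"
    proof
      assume *: "\<forall>i\<in>{1..l}. (i \<in> I \<longleftrightarrow> i \<in> I') \<and> (i \<in> I \<longrightarrow> \<alpha> i = \<alpha>' i)"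
      then have "I = I'" using p(2) q(2) by blast
      moreover have "\<alpha> = \<alpha>'"
        using p(2,3) q(3) * unfolding \<open>I = I'\<close> by (intro PiE_ext) auto
      ultimately show "p = q" using p q by simp
    qed (use p q in simp)
    finally show "(\<Sum>\<delta>\<in>cart_power \<Delta> l. (case p of (I, \<alpha>) \<Rightarrow> \<lambda>\<delta>. \<Prod>i\<in>{1..l}. v I \<alpha> i (\<delta> i)) \<delta> *
        (case q of (I, \<alpha>) \<Rightarrow> \<lambda>\<delta>. diff_prod I \<alpha> (\<lambda>_. b) \<delta>) \<delta>) = of_bool (p = q)"
      by (simp add: p(1) q(1))
  qed
  ultimately show ?thesis by (meson enat_ord_simps(1) order_trans)
qed

text \<open>
  The constant \<open>1\<close> and the functions \<open>e\<^sub>a - e\<^sub>b\<close> of single coordinates, for \<open>a\<close> different from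
  \<open>b\<close> and from a third point \<open>c\<close>, are independent: at the constant point \<open>c\<close> only the constant
  function survives, and changing the \<open>i\<close>-th coordinate to \<open>a\<close> detects \<open>e\<^sub>a - e\<^sub>b\<close> in the
  coordinate \<open>i\<close>.
\<close>

lemma edim_ge_if_contains_degrees_0_1:
  fixes scale :: "'f::field \<Rightarrow> 'v::ab_group_add \<Rightarrow> 'v"
  assumes vs: "vector_space scale" and sub: "module.subspace scale V"
    and phi: "\<phi> \<in> cart_power \<Delta> l \<rightarrow> V"
    and inv: "invariant_functions \<Delta> l (pulled_back_functionals scale V (cart_power \<Delta> l) \<phi>)"
    and deg: "invariant_functions.contains_degree \<Delta> l
        (pulled_back_functionals scale V (cart_power \<Delta> l) \<phi>) 0"
      "invariant_functions.contains_degree \<Delta> l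
        (pulled_back_functionals scale V (cart_power \<Delta> l) \<phi>) 1"
    and k3: "card \<Delta> \<ge> 3"
  shows "enat ((card \<Delta> - 2) * l + 1) \<le> edim scale V"
proof -
  interpret invariant_functions \<Delta> l "pulled_back_functionals scale V (cart_power \<Delta> l) \<phi>" by (rule inv)
  obtain b where b: "b \<in> \<Delta>" using k3 by fastforce
  have "card (\<Delta> - {b}) \<noteq> 0" using k3 b finite_\<Delta> by simp
  then have "\<Delta> - {b} \<noteq> {}" by (intro notI) simp
  then obtain c where c: "c \<in> \<Delta>" "c \<noteq> b" by blast
  \<comment> \<open>Coordinates start at 1, so the index 0 is free to stand for the constant function.\<close>
  define J where "J = insert (0, b) ({1..l} \<times> (\<Delta> - {b, c}))"
  have "card (\<Delta> - {b, c}) = card \<Delta> - 2" using b c finite_\<Delta> by (simp add: card_Diff_subset)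
  then have "card J = (card \<Delta> - 2) * l + 1"
    using finite_\<Delta> by (simp add: J_def card_cartesian_product mult.commute)
  moreover have "enat (card J) \<le> edim scale V"
  proof -
    define base where "base = (\<lambda>i\<in>{1..l}. c)"
    define g where "g j \<delta> = (case j of (i, a) \<Rightarrow>
      (if i = 0 then 1 else of_bool (\<delta> i = a) - of_bool (\<delta> i = b) :: 'f))" for j and \<delta> :: "nat \<Rightarrow> 'a"
    define K where "K j \<delta> = (case j of (i, a) \<Rightarrow>
      (if i = 0 then of_bool (\<delta> = base) else of_bool (\<delta> = base(i := a)) - of_bool (\<delta> = base) :: 'f))"
      for j and \<delta> :: "nat \<Rightarrow> 'a"
    show ?thesis
    proof (rule biorthogonal_card_le_edim[OF vs sub phi, where g = g and K = K])
      show "finite J" using finite_\<Delta> by (simp add: J_def)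
      show "g j \<in> pulled_back_functionals scale V (cart_power \<Delta> l) \<phi>" if jJ: "j \<in> J" for j
      proof (cases "fst j = 0")
        case True
        then have "g j = diff_prod {} (\<lambda>_. b) (\<lambda>_. b)"
          by (auto simp: g_def diff_prod_def fun_eq_iff split: prod.split)
        then show ?thesis using deg(1) unfolding contains_degree_def by simp
      next
        case False
        then obtain i a where j: "j = (i, a)" "i \<in> {1..l}" "a \<in> \<Delta>"
          using jJ by (auto simp: J_def)
        then have "g j = diff_prod {i} (\<lambda>_. a) (\<lambda>_. b)"
          by (simp add: g_def diff_prod_def fun_eq_iff)
        then show ?thesis using deg(2) j b unfolding contains_degree_def by simp
      qed
      fix p q assume p: "p \<in> J" and q: "q \<in> J"
      have base: "base \<in> cart_power \<Delta> l" using c by (auto simp: base_def)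
      have upd: "base(i := a) \<in> cart_power \<Delta> l" if "i \<in> {1..l}" "a \<in> \<Delta>" for i a
        using base that by (auto simp: PiE_iff extensional_def)
      have ev: "(\<Sum>\<delta>\<in>cart_power \<Delta> l. of_bool (\<delta> = \<epsilon>) * f \<delta>) = (f \<epsilon> :: 'f)"
        if "\<epsilon> \<in> cart_power \<Delta> l" for \<epsilon> f
      proof -
        have "(\<Sum>\<delta>\<in>cart_power \<Delta> l. of_bool (\<delta> = \<epsilon>) * f \<delta>) =
            (\<Sum>\<delta>\<in>cart_power \<Delta> l. if \<delta> = \<epsilon> then f \<delta> else 0)"
          by (rule sum.cong) auto
        then show ?thesis using that finite_\<Delta> by (simp add: finite_PiE)
      qed
      obtain i a where p': "p = (i, a)" by (cases p)
      obtain i' a' where q': "q = (i', a')" by (cases q)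
      have "(\<Sum>\<delta>\<in>cart_power \<Delta> l. K p \<delta> * g q \<delta>) =
          (if i = 0 then g q base else g q (base(i := a)) - g q base)"
      proof (cases "i = 0")
        case True
        then show ?thesis using ev[OF base, of "g q"] by (simp add: K_def p')
      next
        case False
        then have "base(i := a) \<in> cart_power \<Delta> l" using p upd by (auto simp: J_def p')
        then show ?thesis
          using False ev[OF base, of "g q"] ev[of "base(i := a)" "g q"]
          by (simp add: K_def p' left_diff_distrib sum_subtractf)
      qed
      also have "\<dots> = of_bool (p = q)"
        using p q b c by (auto simp: J_def p' q' g_def base_def)
      finally show "(\<Sum>\<delta>\<in>cart_power \<Delta> l. K p \<delta> * g q \<delta>) = of_bool (p = q)" .
    qed
  qed
  ultimately show ?thesis by simp
qed

section \<open>The lower bound\<close>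

lemma separating_functional:
  fixes scale :: "'f::field \<Rightarrow> 'v::ab_group_add \<Rightarrow> 'v"
  assumes "vector_space scale" "x \<noteq> y"
  obtains L where "functional_on scale V L" "L x \<noteq> L y"
proof -
  interpret v: vector_space scale by fact
  interpret f: vector_space "(*) :: 'f \<Rightarrow> 'f \<Rightarrow> 'f" by unfold_locales (auto simp: algebra_simps)
  interpret p: vector_space_pair scale "(*) :: 'f \<Rightarrow> 'f \<Rightarrow> 'f" ..
  have "v.independent {x - y}" using assms(2) by (simp add: v.independent_insert)
  then obtain L where L: "Vector_Spaces.linear scale (*) L" "L (x - y) = 1"
    using p.linear_independent_extend[of "{x - y}" "\<lambda>_. 1"] by auto
  interpret L: Vector_Spaces.linear scale "(*)" L by fact
  show thesis
    by (rule that[of L]) (use L(2) in \<open>auto simp: functional_on_def L.add L.scale L.diff\<close>)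
qed

lemma invariant_functions_pulled_back:
  fixes scale :: "'f::field \<Rightarrow> 'v::ab_group_add \<Rightarrow> 'v"
  assumes rep: "action_representation scale V (wreath l (BijGroup \<Delta>) (sym_group l))
      (cart_power \<Delta> l) (product_action \<Delta> l) \<rho> \<phi>"
    and "finite \<Delta>"
  shows "invariant_functions \<Delta> l (pulled_back_functionals scale V (cart_power \<Delta> l) \<phi>)"
proof -
  let ?G = "wreath l (BijGroup \<Delta>) (sym_group l)" and ?\<Omega> = "cart_power \<Delta> l"
  have vs: "vector_space scale" and sub: "module.subspace scale V"
    and rho: "\<rho> \<in> hom ?G (GL_on scale V)" and phi: "\<phi> \<in> ?\<Omega> \<rightarrow> V"
    and eqv: "\<And>g \<omega>. g \<in> carrier ?G \<Longrightarrow> \<omega> \<in> ?\<Omega> \<Longrightarrow> \<phi> (product_action \<Delta> l g \<omega>) = \<rho> g (\<phi> \<omega>)"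
    using rep unfolding action_representation_def by auto
  show ?thesis
  proof
    show "finite \<Delta>" by fact
  next
    fix f g assume "f \<in> pulled_back_functionals scale V ?\<Omega> \<phi>" "\<And>\<delta>. \<delta> \<in> ?\<Omega> \<Longrightarrow> g \<delta> = f \<delta>"
    then show "g \<in> pulled_back_functionals scale V ?\<Omega> \<phi>"
      unfolding pulled_back_functionals_def by auto
  next
    show "(\<lambda>_. 0) \<in> pulled_back_functionals scale V ?\<Omega> \<phi>"
      unfolding pulled_back_functionals_def functional_on_def
      by (auto intro!: exI[of _ "\<lambda>_. 0"])
  next
    fix f g assume "f \<in> pulled_back_functionals scale V ?\<Omega> \<phi>" "g \<in> pulled_back_functionals scale V ?\<Omega> \<phi>"
    then obtain L M where "functional_on scale V L" "functional_on scale V M"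
      "\<forall>\<omega>\<in>?\<Omega>. f \<omega> = L (\<phi> \<omega>)" "\<forall>\<omega>\<in>?\<Omega>. g \<omega> = M (\<phi> \<omega>)"
      unfolding pulled_back_functionals_def by auto
    then show "(\<lambda>\<delta>. f \<delta> + g \<delta>) \<in> pulled_back_functionals scale V ?\<Omega> \<phi>"
      unfolding pulled_back_functionals_def functional_on_def mem_Collect_eq
      by (intro exI[of _ "\<lambda>x. L x + M x"]) (simp add: algebra_simps)
  next
    fix f c assume "f \<in> pulled_back_functionals scale V ?\<Omega> \<phi>"
    then obtain L where "functional_on scale V L" "\<forall>\<omega>\<in>?\<Omega>. f \<omega> = L (\<phi> \<omega>)"
      unfolding pulled_back_functionals_def by auto
    then show "(\<lambda>\<delta>. c * f \<delta>) \<in> pulled_back_functionals scale V ?\<Omega> \<phi>"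
      unfolding pulled_back_functionals_def functional_on_def mem_Collect_eq
      by (intro exI[of _ "\<lambda>x. c * L x"]) (simp add: algebra_simps)
  next
    fix f h \<sigma>
    assume "f \<in> pulled_back_functionals scale V ?\<Omega> \<phi>" and h: "h \<in> {1..l} \<rightarrow>\<^sub>E Bij \<Delta>"
      and s: "\<sigma> permutes {1..l}"
    then obtain L where L: "functional_on scale V L" "\<forall>\<omega>\<in>?\<Omega>. f \<omega> = L (\<phi> \<omega>)"
      unfolding pulled_back_functionals_def by auto
    have gG: "(h, \<sigma>) \<in> carrier ?G"
      using h s by (simp add: wreath_def sym_group_carrier BijGroup_def)
    have B: "\<rho> (h, \<sigma>) \<in> Bij V"
      "\<forall>x\<in>V. \<forall>y\<in>V. \<rho> (h, \<sigma>) (x + y) = \<rho> (h, \<sigma>) x + \<rho> (h, \<sigma>) y"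
      "\<forall>c. \<forall>x\<in>V. \<rho> (h, \<sigma>) (scale c x) = scale c (\<rho> (h, \<sigma>) x)"
      using hom_carrier[OF rho] gG by (auto simp: GL_on_def)
    have V: "\<rho> (h, \<sigma>) x \<in> V" if "x \<in> V" for x
      using Bij_imp_funcset[OF B(1)] that by blast
    have P: "product_action \<Delta> l (h, \<sigma>) \<omega> \<in> ?\<Omega>" if "\<omega> \<in> ?\<Omega>" for \<omega>
      using Bij_imp_funcset[OF product_action_Bij[of l h \<Delta> \<sigma>]] h s that by blast
    show "(\<lambda>\<delta>. f (product_action \<Delta> l (h, \<sigma>) \<delta>)) \<in> pulled_back_functionals scale V ?\<Omega> \<phi>"
      unfolding pulled_back_functionals_def mem_Collect_eq
    proof (intro exI[of _ "\<lambda>x. L (\<rho> (h, \<sigma>) x)"] conjI ballI)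
      show "functional_on scale V (\<lambda>x. L (\<rho> (h, \<sigma>) x))"
        using L(1) B(2,3) V by (simp add: functional_on_def)
      show "f (product_action \<Delta> l (h, \<sigma>) \<omega>) = L (\<rho> (h, \<sigma>) (\<phi> \<omega>))" if "\<omega> \<in> ?\<Omega>" for \<omega>
        using L(2) P[OF that] eqv[OF gG that] by simp
    qed
  qed
qed

lemma edim_representation_ge:
  fixes scale :: "'f::field \<Rightarrow> 'v::ab_group_add \<Rightarrow> 'v"
  assumes rep: "action_representation scale V (wreath l (BijGroup \<Delta>) (sym_group l))
      (cart_power \<Delta> l) (product_action \<Delta> l) \<rho> \<phi>"
    and fin: "finite \<Delta>" and k3: "card \<Delta> \<ge> 3" and l: "l \<ge> 1"
  shows "enat (if of_nat (card \<Delta>) = (0 :: 'f) then (card \<Delta> - 2) * l + 1 else (card \<Delta> - 1) * l)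
    \<le> edim scale V"
proof -
  let ?\<Omega> = "cart_power \<Delta> l"
  have vs: "vector_space scale" and sub: "module.subspace scale V"
    and phi: "\<phi> \<in> ?\<Omega> \<rightarrow> V" "inj_on \<phi> ?\<Omega>"
    using rep unfolding action_representation_def by auto
  have inv: "invariant_functions \<Delta> l (pulled_back_functionals scale V ?\<Omega> \<phi>)"
    by (rule invariant_functions_pulled_back[OF rep fin])
  then interpret invariant_functions \<Delta> l "pulled_back_functionals scale V ?\<Omega> \<phi>" .
  obtain b where b: "b \<in> \<Delta>" using k3 by fastforce
  have "card (\<Delta> - {b}) \<noteq> 0" using k3 b fin by simp
  then have "\<Delta> - {b} \<noteq> {}" by (intro notI) simp
  then obtain c where c: "c \<in> \<Delta>" "c \<noteq> b" by blast
  let ?\<beta> = "\<lambda>i\<in>{1..l}. b" and ?\<gamma> = "\<lambda>i\<in>{1..l}. c"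
  have mem: "?\<beta> \<in> ?\<Omega>" "?\<gamma> \<in> ?\<Omega>" using b c by auto
  have "?\<beta> 1 \<noteq> ?\<gamma> 1" using c l by simp
  then have "?\<beta> \<noteq> ?\<gamma>" by (rule contrapos_nn) (rule fun_cong)
  then have "\<phi> ?\<beta> \<noteq> \<phi> ?\<gamma>" using mem phi(2) by (meson inj_onD)
  then obtain L where L: "functional_on scale V L" "L (\<phi> ?\<beta>) \<noteq> L (\<phi> ?\<gamma>)"
    using separating_functional[OF vs] by blast
  have "(\<lambda>\<delta>. L (\<phi> \<delta>)) \<in> pulled_back_functionals scale V ?\<Omega> \<phi>"
    using L(1) by (auto simp: pulled_back_functionals_def)
  then obtain m where m: "1 \<le> m" "m \<le> l" "contains_degree m"
    using contains_some_degree[OF _ mem L(2)] by blast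
  show ?thesis
  proof (cases "of_nat (card \<Delta>) = (0 :: 'f)")
    case True
    have down: "contains_degree (m - n)" for n
    proof (induction n)
      case (Suc n)
      show ?case
      proof (cases "n < m")
        case True
        then have "m - n = Suc (m - Suc n)" by simp
        then show ?thesis
          using contains_lower_degree[OF \<open>of_nat (card \<Delta>) = 0\<close> _ _ ] Suc m(2) b
          by (metis diff_le_self empty_iff le_trans)
      qed (use Suc in simp)
    qed (use m in simp)
    have "contains_degree 0" "contains_degree 1"
      using down[of m] down[of "m - 1"] m(1) by simp_all
    then show ?thesis
      using edim_ge_if_contains_degrees_0_1[OF vs sub phi(1) inv _ _ k3] True by simp
  next
    case False
    then show ?thesis
      using edim_ge_if_contains_degree[OF vs sub phi(1) inv m(3,1,2) False k3] by simp
  qed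
qed

section \<open>The upper bound\<close>

text \<open>
  A representation is determined by what it does on a spanning set, so linear maps \<open>T g\<close> of a larger
  space that permute the vectors \<open>\<phi> \<omega>\<close> as the group does restrict to a representation on their span.
  This spares the verification that \<open>g \<mapsto> T g\<close> is a homomorphism.
\<close>

lemma LinDim_le_if_span:
  fixes scale :: "'f::field \<Rightarrow> 'v::ab_group_add \<Rightarrow> 'v"
  assumes vs: "vector_space scale" and act: "group_action G \<Omega> act"
    and lin: "\<And>g. g \<in> carrier G \<Longrightarrow> Vector_Spaces.linear scale scale (T g)"
    and eqv: "\<And>g \<omega>. g \<in> carrier G \<Longrightarrow> \<omega> \<in> \<Omega> \<Longrightarrow> T g (\<phi> \<omega>) = \<phi> (act g \<omega>)"
    and inj: "inj_on \<phi> \<Omega>" and C: "finite C" "\<phi> ` \<Omega> \<subseteq> module.span scale C"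
  shows "LinDim TYPE('f) G \<Omega> act \<le> enat (card C)"
proof -
  interpret v: vector_space scale by fact
  interpret p: vector_space_pair scale scale ..
  interpret A: group_action G \<Omega> act by fact
  interpret G: group G using A.group_hom unfolding group_hom_def by blast
  define V where "V = v.span (\<phi> ` \<Omega>)"
  define \<rho> where "\<rho> g = restrict (T g) V" for g
  have elem: "act g \<omega> \<in> \<Omega>" if "g \<in> carrier G" "\<omega> \<in> \<Omega>" for g \<omega>
    using A.element_image that by blast
  have phiV: "\<phi> \<omega> \<in> V" if "\<omega> \<in> \<Omega>" for \<omega>
    using that unfolding V_def by (simp add: v.span_base)
  have TV: "T g x \<in> V" if g: "g \<in> carrier G" and x: "x \<in> V" for g x
  proof -
    interpret T: Vector_Spaces.linear scale scale "T g" by (rule lin[OF g])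
    have "T g ` V = v.span (T g ` \<phi> ` \<Omega>)" unfolding V_def by (rule T.span_image[symmetric])
    also have "\<dots> \<subseteq> V" unfolding V_def
      by (rule v.span_mono) (use eqv[OF g] elem[OF g] in auto)
    finally show ?thesis using x by blast
  qed
  have Tm: "T (g \<otimes>\<^bsub>G\<^esub> h) x = T g (T h x)" if gh: "g \<in> carrier G" "h \<in> carrier G" and x: "x \<in> V" for g h x
  proof -
    have "Vector_Spaces.linear scale scale (T g \<circ> T h)"
      by (rule Vector_Spaces.linear_compose[OF lin[OF gh(2)] lin[OF gh(1)]])
    moreover have "T (g \<otimes>\<^bsub>G\<^esub> h) y = (T g \<circ> T h) y" if "y \<in> \<phi> ` \<Omega>" for y
      using that gh eqv elem A.composition_rule by (auto simp: G.m_closed)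
    ultimately have "T (g \<otimes>\<^bsub>G\<^esub> h) x = (T g \<circ> T h) x"
      by (rule p.linear_eq_on_span[OF lin[OF G.m_closed[OF gh]] _ _ x[unfolded V_def]])
    then show ?thesis by simp
  qed
  have T1: "T \<one>\<^bsub>G\<^esub> x = x" if x: "x \<in> V" for x
  proof -
    have "T \<one>\<^bsub>G\<^esub> y = id y" if y: "y \<in> \<phi> ` \<Omega>" for y
    proof -
      obtain \<omega> where w: "\<omega> \<in> \<Omega>" "y = \<phi> \<omega>" using y by blast
      then have "act \<one>\<^bsub>G\<^esub> \<omega> = \<omega>" using fun_cong[OF A.id_eq_one, of \<omega>] by simp
      then show ?thesis using eqv[OF G.one_closed w(1)] w by simp
    qed
    then have "T \<one>\<^bsub>G\<^esub> x = id x"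
      by (rule p.linear_eq_on_span[OF lin[OF G.one_closed] v.linear_id _ x[unfolded V_def]])
    then show ?thesis by simp
  qed
  have Bij: "\<rho> g \<in> Bij V" if g: "g \<in> carrier G" for g
  proof -
    have "bij_betw (T g) V V"
    proof (rule bij_betw_byWitness[where f' = "T (inv\<^bsub>G\<^esub> g)"])
      show "\<forall>x\<in>V. T (inv\<^bsub>G\<^esub> g) (T g x) = x" "\<forall>x\<in>V. T g (T (inv\<^bsub>G\<^esub> g) x) = x"
        using g T1 by (simp_all flip: Tm)
    qed (use TV g in auto)
    then show ?thesis by (simp add: Bij_def \<rho>_def bij_betw_restrict_eq)
  qed
  have sub: "v.subspace V" by (simp add: V_def)
  have "action_representation scale V G \<Omega> act \<rho> \<phi>"
    unfolding action_representation_def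
  proof (intro conjI ballI)
    show "\<rho> \<in> hom G (GL_on scale V)"
    proof (rule homI)
      fix g assume g: "g \<in> carrier G"
      interpret T: Vector_Spaces.linear scale scale "T g" by (rule lin[OF g])
      show "\<rho> g \<in> carrier (GL_on scale V)"
        using Bij[OF g] v.subspace_add[OF sub] v.subspace_scale[OF sub]
        by (simp add: GL_on_def \<rho>_def T.add T.scale)
    next
      fix g h assume gh: "g \<in> carrier G" "h \<in> carrier G"
      have "\<rho> (g \<otimes>\<^bsub>G\<^esub> h) = compose V (\<rho> g) (\<rho> h)"
        using gh TV Tm by (auto simp: \<rho>_def compose_def)
      then show "\<rho> (g \<otimes>\<^bsub>G\<^esub> h) = \<rho> g \<otimes>\<^bsub>GL_on scale V\<^esub> \<rho> h"
        using Bij gh by (simp add: GL_on_def BijGroup_def)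
    qed
  qed (use vs sub phiV inj eqv in \<open>auto simp: \<rho>_def\<close>)
  then have "LinDim TYPE('f) G \<Omega> act \<le> edim scale V" by (rule LinDim_le)
  also have "\<dots> \<le> enat (card C)"
  proof -
    have VC: "V \<subseteq> v.span C"
      unfolding V_def using C(2) v.span_minimal v.subspace_span by blast
    obtain B where B: "B \<subseteq> V" "v.independent B" "V \<subseteq> v.span B" "card B = v.dim V"
      by (rule v.basis_exists)
    have "finite B" using v.independent_span_bound[OF C(1) B(2)] B(1) VC by blast
    moreover have "V = v.span B" using B v.span_minimal[OF B(1) sub] by blast
    ultimately have "\<exists>B. finite B \<and> V = v.span B" by blast
    then show ?thesis
      unfolding edim_def using v.dim_le_card[OF VC C(1)] by simp
  qed
  finally show ?thesis .
qed

definition pointwise_scale :: "'f::field \<Rightarrow> ('x \<Rightarrow> 'f) \<Rightarrow> ('x \<Rightarrow> 'f)" where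
  "pointwise_scale c v = (\<lambda>x. c * v x)"

lemma vector_space_pointwise_scale: "vector_space (pointwise_scale :: 'f::field \<Rightarrow> _)"
  by unfold_locales (auto simp: pointwise_scale_def fun_eq_iff algebra_simps)

lemma sum_apply: "(\<Sum>a\<in>A. f a) x = (\<Sum>a\<in>A. f a x)"
  for f :: "'b \<Rightarrow> 'x \<Rightarrow> 'f::field"
  by (induction A rule: infinite_finite_induct) auto

text \<open>
  The quotient of \<open>F\<^sup>\<Delta>\<close> by the constants is embedded into functions on \<open>\<Delta> \<times> \<Delta>\<close> by sending \<open>f\<close>
  to \<open>(a, b) \<mapsto> f a - f b\<close>. Unlike a choice of coordinates on the quotient, this keeps the group acting
  by permutations of the arguments. The vector below is the class of \<open>e\<^sub>x\<close> in the \<open>i\<close>-th copy.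
\<close>

definition point_vector :: "'a set \<Rightarrow> nat \<Rightarrow> 'a \<Rightarrow> nat \<times> 'a \<times> 'a \<Rightarrow> 'f::field" where
  "point_vector \<Delta> i x = (\<lambda>(j, a, b).
     if j = i \<and> a \<in> \<Delta> \<and> b \<in> \<Delta> then of_bool (x = a) - of_bool (x = b) else 0)"

definition cube_vector :: "'a set \<Rightarrow> nat \<Rightarrow> (nat \<Rightarrow> 'a) \<Rightarrow> nat \<times> 'a \<times> 'a \<Rightarrow> 'f::field" where
  "cube_vector \<Delta> l \<delta> = (\<Sum>i\<in>{1..l}. point_vector \<Delta> i (\<delta> i))"

lemma cube_vector_apply:
  "cube_vector \<Delta> l \<delta> (j, a, b) =
    (if j \<in> {1..l} \<and> a \<in> \<Delta> \<and> b \<in> \<Delta> then of_bool (\<delta> j = a) - of_bool (\<delta> j = b) else 0 :: 'f::field)"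
proof -
  have "cube_vector \<Delta> l \<delta> (j, a, b) =
      (\<Sum>i\<in>{1..l}. if i = j then point_vector \<Delta> j (\<delta> j) (j, a, b) else 0 :: 'f)"
    unfolding cube_vector_def sum_apply
    by (rule sum.cong) (auto simp: point_vector_def)
  then show ?thesis by (simp add: point_vector_def)
qed

lemma sum_point_vector:
  assumes "finite \<Delta>"
  shows "(\<Sum>x\<in>\<Delta>. point_vector \<Delta> i x z) = (0 :: 'f::field)"
proof -
  obtain j a b where z: "z = (j, a, b)" by (cases z)
  show ?thesis
    using assms
    by (cases "j = i \<and> a \<in> \<Delta> \<and> b \<in> \<Delta>") (auto simp: z point_vector_def sum_subtractf of_bool_def)
qed

text \<open>
  Two different values \<open>\<delta> i\<close> and \<open>\<epsilon> i\<close> are told apart by the entry at \<open>(\<delta> i, z)\<close> with \<open>z\<close> a third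
  point of \<open>\<Delta>\<close>.
\<close>

lemma inj_on_cube_vector:
  assumes "card \<Delta> \<ge> 3"
  shows "inj_on (cube_vector \<Delta> l :: _ \<Rightarrow> _ \<Rightarrow> 'f::field) (cart_power \<Delta> l)"
proof (rule inj_onI)
  fix \<delta> \<epsilon> assume d: "\<delta> \<in> cart_power \<Delta> l" and e: "\<epsilon> \<in> cart_power \<Delta> l"
    and eq: "(cube_vector \<Delta> l \<delta> :: _ \<Rightarrow> 'f) = cube_vector \<Delta> l \<epsilon>"
  show "\<delta> = \<epsilon>"
  proof (rule PiE_ext[OF d e], rule ccontr)
    fix i assume i: "i \<in> {1..l}" and ne: "\<delta> i \<noteq> \<epsilon> i"
    have mem: "\<delta> i \<in> \<Delta>" "\<epsilon> i \<in> \<Delta>" using d e i by auto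
    have fin: "finite \<Delta>" using assms card.infinite by fastforce
    have "card (\<Delta> - {\<delta> i, \<epsilon> i}) \<noteq> 0"
      using assms fin mem ne by (simp add: card_Diff_subset)
    then have "\<Delta> - {\<delta> i, \<epsilon> i} \<noteq> {}" by (intro notI) simp
    then obtain z where z: "z \<in> \<Delta>" "z \<noteq> \<delta> i" "z \<noteq> \<epsilon> i" by blast
    have "cube_vector \<Delta> l \<delta> (i, \<delta> i, z) = (cube_vector \<Delta> l \<epsilon> (i, \<delta> i, z) :: 'f)"
      using eq by simp
    then show False using i mem z ne by (simp add: cube_vector_apply)
  qed
qed

definition cube_map ::
  "'a set \<Rightarrow> nat \<Rightarrow> (nat \<Rightarrow> 'a \<Rightarrow> 'a) \<times> (nat \<Rightarrow> nat) \<Rightarrow> (nat \<times> 'a \<times> 'a \<Rightarrow> 'f::field) \<Rightarrow> nat \<times> 'a \<times> 'a \<Rightarrow> 'f" where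
  "cube_map \<Delta> l = (\<lambda>(h, \<sigma>) v (i, a, b). if i \<in> {1..l} \<and> a \<in> \<Delta> \<and> b \<in> \<Delta>
     then v (inv' \<sigma> i, inv_into \<Delta> (h i) a, inv_into \<Delta> (h i) b) else 0)"

lemma linear_cube_map:
  "Vector_Spaces.linear pointwise_scale pointwise_scale (cube_map (\<Delta> :: 'a set) l g :: (_ \<Rightarrow> 'f::field) \<Rightarrow> _)"
proof -
  interpret vector_space "pointwise_scale :: 'f \<Rightarrow> (nat \<times> 'a \<times> 'a \<Rightarrow> 'f) \<Rightarrow> _"
    by (rule vector_space_pointwise_scale)
  show ?thesis
    by unfold_locales (auto simp: cube_map_def pointwise_scale_def fun_eq_iff split: prod.split)
qed

lemma cube_map_cube_vector:
  assumes g: "g \<in> carrier (wreath l (BijGroup \<Delta>) (sym_group l))" and d: "\<delta> \<in> cart_power \<Delta> l"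
  shows "cube_map \<Delta> l g (cube_vector \<Delta> l \<delta>) =
    (cube_vector \<Delta> l (product_action \<Delta> l g \<delta>) :: _ \<Rightarrow> 'f::field)"
proof
  fix z :: "nat \<times> 'a \<times> 'a"
  obtain h \<sigma> where hs: "g = (h, \<sigma>)" by (cases g)
  obtain i a b where z: "z = (i, a, b)" by (cases z)
  have h: "h i \<in> Bij \<Delta>" if "i \<in> {1..l}" for i
    using g that by (auto simp: hs wreath_def BijGroup_def)
  have s: "\<sigma> permutes {1..l}" using g by (simp add: hs wreath_def sym_group_carrier)
  show "cube_map \<Delta> l g (cube_vector \<Delta> l \<delta>) z = (cube_vector \<Delta> l (product_action \<Delta> l g \<delta>) z :: 'f)"
  proof (cases "i \<in> {1..l} \<and> a \<in> \<Delta> \<and> b \<in> \<Delta>")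
    case True
    have bij: "bij_betw (h i) \<Delta> \<Delta>" using h True by (simp add: Bij_def)
    have si: "inv' \<sigma> i \<in> {1..l}" using permutes_in_image[OF permutes_inv[OF s]] True by blast
    have dm: "\<delta> (inv' \<sigma> i) \<in> \<Delta>" using d si by blast
    have iv: "inv_into \<Delta> (h i) y \<in> \<Delta>" "(\<delta> (inv' \<sigma> i) = inv_into \<Delta> (h i) y) = (h i (\<delta> (inv' \<sigma> i)) = y)"
      if "y \<in> \<Delta>" for y
    proof -
      have y: "y \<in> h i ` \<Delta>" using bij that by (simp add: bij_betw_def)
      show "inv_into \<Delta> (h i) y \<in> \<Delta>" using y by (rule inv_into_into)
      show "(\<delta> (inv' \<sigma> i) = inv_into \<Delta> (h i) y) = (h i (\<delta> (inv' \<sigma> i)) = y)"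
        using f_inv_into_f[OF y] inv_into_f_f[of "h i" \<Delta>, OF _ dm] bij by (auto simp: bij_betw_def)
    qed
    show ?thesis
      using True si d iv by (simp add: z hs cube_map_def cube_vector_apply product_action_def
          del: atLeastAtMost_iff One_nat_def)
  qed (auto simp: z hs cube_map_def cube_vector_apply)
qed

lemma LinDim_cube_le:
  fixes C :: "(nat \<times> 'a \<times> 'a \<Rightarrow> 'f::field) set"
  assumes "card \<Delta> \<ge> 3" "finite C"
    and span: "\<And>\<delta>. \<delta> \<in> cart_power \<Delta> l \<Longrightarrow> cube_vector \<Delta> l \<delta> \<in> module.span pointwise_scale C"
  shows "LinDim TYPE('f) (wreath l (BijGroup \<Delta>) (sym_group l)) (cart_power \<Delta> l) (product_action \<Delta> l)
    \<le> enat (card C)"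
proof (rule LinDim_le_if_span[OF vector_space_pointwise_scale, where T = "cube_map \<Delta> l" and \<phi> = "cube_vector \<Delta> l"])
  have "subgroup (carrier (BijGroup \<Delta>)) (BijGroup \<Delta>)" "subgroup (carrier (sym_group l)) (sym_group l)"
    by (intro group.subgroup_self group_BijGroup sym_group_is_group)+
  from group_action_product_action[OF this]
  show "group_action (wreath l (BijGroup \<Delta>) (sym_group l)) (cart_power \<Delta> l) (product_action \<Delta> l)"
    by simp
qed (use assms linear_cube_map cube_map_cube_vector inj_on_cube_vector in auto)

text \<open>
  In each of the \<open>l\<close> copies, the \<open>k\<close> point vectors add up to zero, so one of them can be omitted from
  the spanning set.
\<close>

lemma LinDim_cube_upper_bound:
  assumes "card \<Delta> \<ge> 3"
  shows "LinDim TYPE('f::field) (wreath l (BijGroup \<Delta>) (sym_group l)) (cart_power \<Delta> l) (product_action \<Delta> l)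
    \<le> enat ((card \<Delta> - 1) * l)"
proof -
  interpret vector_space "pointwise_scale :: 'f \<Rightarrow> (nat \<times> 'a \<times> 'a \<Rightarrow> 'f) \<Rightarrow> _"
    by (rule vector_space_pointwise_scale)
  have fin: "finite \<Delta>" using assms card.infinite by fastforce
  obtain b where b: "b \<in> \<Delta>" using assms by fastforce
  let ?pv = "point_vector \<Delta> :: _ \<Rightarrow> _ \<Rightarrow> _ \<Rightarrow> 'f"
  define C where "C = (\<lambda>(i, x). ?pv i x) ` ({1..l} \<times> (\<Delta> - {b}))"
  have C: "?pv i x \<in> span C" if "i \<in> {1..l}" "x \<in> \<Delta>" for i x
  proof -
    have base: "?pv i y \<in> span C" if "y \<in> \<Delta> - {b}" for y
      using that \<open>i \<in> {1..l}\<close> by (intro span_base) (auto simp: C_def)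
    have "?pv i b = - (\<Sum>y\<in>\<Delta> - {b}. ?pv i y)"
    proof
      fix z
      show "?pv i b z = (- (\<Sum>y\<in>\<Delta> - {b}. ?pv i y)) z"
        using sum_point_vector[OF fin, of i z, where 'f = 'f] sum.remove[OF fin b, of "\<lambda>y. ?pv i y z"]
        by (simp add: sum_apply eq_neg_iff_add_eq_0)
    qed
    moreover have "- (\<Sum>y\<in>\<Delta> - {b}. ?pv i y) \<in> span C"
      using base by (intro span_neg span_sum)
    ultimately show ?thesis using base[of x] that(2) by (cases "x = b") auto
  qed
  have fC: "finite C" using fin by (simp add: C_def)
  have "LinDim TYPE('f) (wreath l (BijGroup \<Delta>) (sym_group l)) (cart_power \<Delta> l) (product_action \<Delta> l)
      \<le> enat (card C)"
  proof (rule LinDim_cube_le[OF assms fC])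
    show "cube_vector \<Delta> l \<delta> \<in> span C" if "\<delta> \<in> cart_power \<Delta> l" for \<delta>
      unfolding cube_vector_def using that by (intro span_sum C) auto
  qed
  also have "card C \<le> card ({1..l} \<times> (\<Delta> - {b}))"
    unfolding C_def using fin by (intro card_image_le) simp
  also have "\<dots> = (card \<Delta> - 1) * l" using b fin by (simp add: card_cartesian_product mult.commute)
  finally show ?thesis by simp
qed

text \<open>
  Every cube vector differs from the one of the constant point \<open>b\<close> by a sum of differences
  \<open>u\<^sub>x - u\<^sub>b\<close> of point vectors. For a fixed coordinate these add up to \<open>0 - k u\<^sub>b\<close>, which
  vanishes when \<open>k = 0\<close> in the field. So, besides \<open>x = b\<close>, a further point \<open>x = c\<close> can be omitted.
\<close>

lemma LinDim_cube_upper_bound_dividing: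
  assumes k3: "card \<Delta> \<ge> 3" and k: "of_nat (card \<Delta>) = (0 :: 'f::field)"
  shows "LinDim TYPE('f) (wreath l (BijGroup \<Delta>) (sym_group l)) (cart_power \<Delta> l) (product_action \<Delta> l)
    \<le> enat ((card \<Delta> - 2) * l + 1)"
proof -
  interpret vector_space "pointwise_scale :: 'f \<Rightarrow> (nat \<times> 'a \<times> 'a \<Rightarrow> 'f) \<Rightarrow> _"
    by (rule vector_space_pointwise_scale)
  have fin: "finite \<Delta>" using k3 card.infinite by fastforce
  obtain b where b: "b \<in> \<Delta>" using k3 by fastforce
  have "card (\<Delta> - {b}) \<noteq> 0" using k3 b fin by simp
  then have "\<Delta> - {b} \<noteq> {}" by (intro notI) simp
  then obtain c where c: "c \<in> \<Delta>" "c \<noteq> b" by blast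
  let ?dv = "\<lambda>i x. point_vector \<Delta> i x - point_vector \<Delta> i b :: _ \<Rightarrow> 'f"
  let ?v = "cube_vector \<Delta> l (\<lambda>_. b) :: _ \<Rightarrow> 'f"
  define C where "C = insert ?v ((\<lambda>(i, x). ?dv i x) ` ({1..l} \<times> (\<Delta> - {b, c})))"
  have C: "?dv i x \<in> span C" if "i \<in> {1..l}" "x \<in> \<Delta>" for i x
  proof -
    have base: "?dv i y \<in> span C" if "y \<in> \<Delta> - {b, c}" for y
      using that \<open>i \<in> {1..l}\<close> by (intro span_base) (auto simp: C_def)
    have "?dv i c = - (\<Sum>y\<in>\<Delta> - {b, c}. ?dv i y)"
    proof
      fix z
      have "(\<Sum>y\<in>\<Delta>. ?dv i y z) = 0"
        using sum_point_vector[OF fin, of i z, where 'f = 'f] k by (simp add: sum_subtractf)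
      moreover have "(\<Sum>y\<in>\<Delta>. ?dv i y z) = ?dv i b z + (?dv i c z + (\<Sum>y\<in>\<Delta> - {b} - {c}. ?dv i y z))"
        using sum.remove[OF fin b, of "\<lambda>y. ?dv i y z"]
          sum.remove[of "\<Delta> - {b}" c "\<lambda>y. ?dv i y z"] fin c by simp
      moreover have "\<Delta> - {b} - {c} = \<Delta> - {b, c}" by blast
      ultimately have "?dv i c z + (\<Sum>y\<in>\<Delta> - {b, c}. ?dv i y z) = 0" by simp
      then show "?dv i c z = (- (\<Sum>y\<in>\<Delta> - {b, c}. ?dv i y)) z"
        by (simp only: eq_neg_iff_add_eq_0 sum_apply uminus_apply)
    qed
    moreover have "- (\<Sum>y\<in>\<Delta> - {b, c}. ?dv i y) \<in> span C"
      using base by (intro span_neg span_sum)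
    moreover have "?dv i b \<in> span C" using span_zero by simp
    ultimately show ?thesis using base[of x] that(2) by (cases "x = b"; cases "x = c") auto
  qed
  have fC: "finite C" using fin by (simp add: C_def)
  have "LinDim TYPE('f) (wreath l (BijGroup \<Delta>) (sym_group l)) (cart_power \<Delta> l) (product_action \<Delta> l)
      \<le> enat (card C)"
  proof (rule LinDim_cube_le[OF k3 fC])
    fix \<delta> assume d: "\<delta> \<in> cart_power \<Delta> l"
    have "?v \<in> span C" by (rule span_base) (simp add: C_def)
    moreover have "(\<Sum>i\<in>{1..l}. ?dv i (\<delta> i)) \<in> span C" using d by (intro span_sum C) auto
    moreover have "cube_vector \<Delta> l \<delta> = ?v + (\<Sum>i\<in>{1..l}. ?dv i (\<delta> i))"
      by (simp add: cube_vector_def sum_subtractf)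
    ultimately show "cube_vector \<Delta> l \<delta> \<in> span C" using span_add by simp
  qed
  also have "card C \<le> Suc (card ({1..l} \<times> (\<Delta> - {b, c})))"
  proof -
    have "card ((\<lambda>(i, x). ?dv i x) ` ({1..l} \<times> (\<Delta> - {b, c}))) \<le> card ({1..l} \<times> (\<Delta> - {b, c}))"
      using fin by (intro card_image_le) simp
    then show ?thesis
      unfolding C_def using fin by (intro order_trans[OF card_insert_le_m1]) auto
  qed
  also have "card (\<Delta> - {b, c}) = card \<Delta> - 2" using b c fin by (simp add: card_Diff_subset)
  then have "Suc (card ({1..l} \<times> (\<Delta> - {b, c}))) = (card \<Delta> - 2) * l + 1"
    by (simp add: card_cartesian_product mult.commute)
  finally show ?thesis by simp
qed

section \<open>The dimension\<close>

theorem theorem1p3: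
  fixes \<Delta> :: "'a set" and k l p :: nat
  assumes "finite \<Delta>" and "card \<Delta> = k" and "k \<ge> 3" and "l \<ge> 2"
    and "CHAR('f::field) = p"
  shows "LinDim TYPE('f) (wreath l (BijGroup \<Delta>) (sym_group l)) (cart_power \<Delta> l) (product_action \<Delta> l) =
    (if p dvd k then enat ((k - 2) * l + 1) else enat ((k - 1) * l))"
proof (rule antisym)
  have char: "of_nat (card \<Delta>) = (0 :: 'f) \<longleftrightarrow> p dvd k"
    using assms(2,5) by (simp add: of_nat_eq_0_iff_char_dvd)
  show "LinDim TYPE('f) (wreath l (BijGroup \<Delta>) (sym_group l)) (cart_power \<Delta> l) (product_action \<Delta> l) \<le>
      (if p dvd k then enat ((k - 2) * l + 1) else enat ((k - 1) * l))"
    using LinDim_cube_upper_bound[of \<Delta> l, where 'f = 'f]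
      LinDim_cube_upper_bound_dividing[of \<Delta> l, where 'f = 'f] char assms(2,3) by simp
  show "(if p dvd k then enat ((k - 2) * l + 1) else enat ((k - 1) * l)) \<le>
      LinDim TYPE('f) (wreath l (BijGroup \<Delta>) (sym_group l)) (cart_power \<Delta> l) (product_action \<Delta> l)"
    unfolding LinDim_def
  proof (rule Inf_greatest)
    fix d
    assume "d \<in> {edim fun_scale V |(V :: (nat \<Rightarrow> 'f) set) \<rho> \<phi>. action_representation fun_scale V
      (wreath l (BijGroup \<Delta>) (sym_group l)) (cart_power \<Delta> l) (product_action \<Delta> l) \<rho> \<phi>}"
    then obtain V :: "(nat \<Rightarrow> 'f) set" and \<rho> \<phi> where d: "d = edim fun_scale V"
      and rep: "action_representation fun_scale V (wreath l (BijGroup \<Delta>) (sym_group l))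
        (cart_power \<Delta> l) (product_action \<Delta> l) \<rho> \<phi>"
      by blast
    show "(if p dvd k then enat ((k - 2) * l + 1) else enat ((k - 1) * l)) \<le> d"
      using edim_representation_ge[OF rep assms(1)] assms(2-4) char
      by (cases "p dvd k") (simp_all add: d)
  qed
qed

end
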